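(* Assume the Lindelöf hypothesis, i.e. $\zeta(\tfrac12+it)=\mathcal{O}(t^{\delta})$ as $t\to\infty$ for every $\delta>0$. Let $\epsilon>0$ be a fixed, arbitrarily small number. For $\tau\in[-\pi,\pi]$ put $$F(\tau,T,H)=\sum_{T\le t_\nu\le T+H} Z[t_\nu(\tau)].$$ Then, as $T\to\infty$, for $H\in(0,T^{1/6+\epsilon}]$, $$F(\tau,T,H)-F(0,T,H)=\mathcal{O}(T^{\epsilon}),$$ uniformly for $\tau\in[-\pi,\pi]$.
   Context: $Z(t)=e^{i\vartheta(t)}\zeta(\tfrac12+it)$ is the (real-valued) Riemann–Siegel (Hardy) function, where $\vartheta(t)=-\frac t2\ln\pi+\operatorname{Im}\ln\Gamma\left(\frac14+i\frac t2\right)$ (continuous branch with $\vartheta(0)=0$). For integers $\nu\ge\nu_0$ ($\nu_0$ a fixed sufficiently large integer) and $\tau\in[-\pi,\pi]$, $t_\nu(\tau)$ is the (large) solution of $\vartheta[t_\nu(\tau)]=\pi\nu+\tau$, and $t_\nu=t_\nu(0)$. Sums $\sum_{T\le t_\nu\le T+H}$ run over all integers $\nu$ with $t_\nu\in[T,T+H]$. The implied constants do not depend on $T$ or $H$. *)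

theory Defs
  imports "HOL-Complex_Analysis.Complex_Analysis" "HOL-Library.Landau_Symbols"
begin

definition is_zeta_continuation :: "(complex \<Rightarrow> complex) \<Rightarrow> bool" where
  "is_zeta_continuation f \<longleftrightarrow> f holomorphic_on (- {1}) \<and>
     (\<forall>s. Re s > 1 \<longrightarrow> (\<lambda>n. of_nat (Suc n) powr (- s)) sums f s)"

text \<open>
  The value at the pole \<open>s = 1\<close> is unspecified; everywhere else the function is determined uniquely,
  see \<open>is_zeta_continuation_unique\<close> and \<open>is_zeta_continuation_zeta\<close> below.
\<close>
definition zeta :: "complex \<Rightarrow> complex" where
  "zeta = (SOME f. is_zeta_continuation f)"

lemma is_zeta_continuation_unique:
  assumes "is_zeta_continuation f" "is_zeta_continuation g" "s \<noteq> 1"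
  shows   "f s = g s"
proof (rule analytic_continuation_open[of "{s. Re s > 1}" "- {1}" f g])
  show "{s. 1 < Re s} \<noteq> {}" by (auto intro: exI[of _ 2])
  show "open {s. 1 < Re s}" by (rule open_halfspace_Re_gt)
  show "connected (- {1 :: complex})" by (rule connected_punctured_universe) auto
  show "f z = g z" if "z \<in> {s. 1 < Re s}" for z
    using assms that sums_unique2 unfolding is_zeta_continuation_def by blast
qed (use assms in \<open>auto simp: is_zeta_continuation_def\<close>)

text \<open>
  Existence of the continuation: summing the Taylor expansion of
  \<open>(n + 1) powr (1 - s) - n powr (1 - s)\<close> in \<open>1 / n\<close> expresses \<open>(s - 1) * zeta s\<close> through
  its values at \<open>s + 1, s + 2, \<dots>\<close> and an error series that converges further to the left.
\<close>
definition zeta_ff :: "nat \<Rightarrow> complex \<Rightarrow> complex" where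
  "zeta_ff i s = (\<Prod>k<i. 1 - s - of_nat k)"

lemma zeta_ff_holomorphic: "zeta_ff i holomorphic_on A"
  unfolding zeta_ff_def by (intro holomorphic_intros)

definition zeta_term :: "nat \<Rightarrow> nat \<Rightarrow> complex \<Rightarrow> complex" where
  "zeta_term m n s = of_nat (Suc n + 1) powr (1 - s) -
     (\<Sum>i\<le>m. zeta_ff i s / fact i * of_nat (Suc n) powr (1 - s - of_nat i))"

lemma zeta_term_holomorphic: "zeta_term m n holomorphic_on A"
  unfolding zeta_term_def
  by (intro holomorphic_intros zeta_ff_holomorphic)
     (auto simp del: of_nat_Suc)

lemma zeta_term_bound:
  assumes s: "Re s > 1 - real m"
  shows "norm (zeta_term m n s) \<le> norm (zeta_ff (Suc m) s) * real (Suc n) powr (- Re s - m)"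
proof -
  define N where "N = Suc n"
  have N: "N > 0" by (simp add: N_def)
  define f where "f = (\<lambda>i x. zeta_ff i s * (1 + x) powr (1 - s - of_nat i))"
  define S where "S = closed_segment (0::complex) 1"
  have S: "\<exists>t. x = of_real t \<and> 0 \<le> t \<and> t \<le> 1" if "x \<in> S" for x
    using that unfolding S_def by (auto simp: closed_segment_def scaleR_conv_of_real)
  have "norm (f 0 (of_real (1/N)) - (\<Sum>i\<le>m. f i 0 * (of_real (1/N) - 0) ^ i / fact i))
          \<le> norm (zeta_ff (Suc m) s) * norm (of_real (1/N) - 0 :: complex) ^ Suc m / fact m"
  proof (rule complex_Taylor[of S])
    show "(f i has_field_derivative f (Suc i) x) (at x within S)" if x: "x \<in> S" for i x
    proof -
      from S[OF x] obtain t where t: "x = of_real t" "0 \<le> t" by auto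
      have "1 + x \<notin> \<real>\<^sub>\<le>\<^sub>0" using t by (auto simp: complex_nonpos_Reals_iff)
      then show ?thesis
        unfolding f_def
        by (auto intro!: derivative_eq_intros
            simp: zeta_ff_def algebra_simps)
    qed
    show "cmod (f (Suc m) x) \<le> norm (zeta_ff (Suc m) s)" if x: "x \<in> S" for x
    proof -
      from S[OF x] obtain t where t: "x = of_real t" "0 \<le> t" by auto
      have "norm ((1 + x) powr (1 - s - of_nat (Suc m))) = (1 + t) powr Re (1 - s - of_nat (Suc m))"
        unfolding t(1) using t(2) by (subst norm_powr_real_powr) auto
      also have "\<dots> \<le> (1 + t) powr 0"
        using s t(2) by (intro powr_mono) auto
      finally have "norm ((1 + x) powr (1 - s - of_nat (Suc m))) \<le> 1" using t(2) by simp
      then show ?thesis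
        unfolding f_def norm_mult by (intro mult_left_le) auto
    qed
    show "complex_of_real (1 / real N) \<in> S"
      using N unfolding S_def closed_segment_def
      by (auto simp: scaleR_conv_of_real intro!: exI[of _ "1 / real N"])
  qed (auto simp: S_def)
  also have "f 0 (of_real (1/N)) - (\<Sum>i\<le>m. f i 0 * (of_real (1/N) - 0) ^ i / fact i)
       = (1 + of_real (1/N)) powr (1 - s) - (\<Sum>i\<le>m. zeta_ff i s / fact i * (of_real (1/N)) ^ i)"
    by (simp add: f_def zeta_ff_def)
  finally have bd: "norm ((1 + of_real (1/N)) powr (1 - s) -
        (\<Sum>i\<le>m. zeta_ff i s / fact i * (of_real (1/N)) ^ i))
      \<le> norm (zeta_ff (Suc m) s) * norm (of_real (1/N) :: complex) ^ Suc m / fact m"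
    by simp
  also have "\<dots> \<le> norm (zeta_ff (Suc m) s) * norm (of_real (1/N) :: complex) ^ Suc m"
    using divide_left_mono[OF fact_ge_1[of m, where ?'a = real], of "norm (zeta_ff (Suc m) s) * norm (of_real (1/N) :: complex) ^ Suc m"]
    by simp
  also have "\<dots> = norm (zeta_ff (Suc m) s) * (1/real N) ^ Suc m"
    by (simp add: norm_divide)
  also have "(1/real N) ^ Suc m = real N powr (- real (Suc m))"
    using N by (subst powr_minus, subst powr_realpow) (simp_all add: power_one_over inverse_eq_divide)
  finally have bd: "norm ((1 + of_real (1/N)) powr (1 - s) -
        (\<Sum>i\<le>m. zeta_ff i s / fact i * (of_real (1/N)) ^ i))
      \<le> norm (zeta_ff (Suc m) s) * real N powr (- real (Suc m))" .
  have e1: "of_nat (N + 1) powr (1 - s) = of_nat N powr (1 - s) * (1 + of_real (1/N)) powr (1 - s)"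
  proof -
    have "of_nat (N + 1) = complex_of_real (real N * (1 + 1 / real N))"
      using N by (simp add: field_simps)
    also have "\<dots> powr (1 - s) = of_real (real N) powr (1 - s) * of_real (1 + 1 / real N) powr (1 - s)"
      unfolding of_real_mult by (rule powr_times_real) auto
    finally show ?thesis by simp
  qed
  have e2: "of_nat N powr (1 - s - of_nat i) = of_nat N powr (1 - s) * (of_real (1/N)) ^ i" for i
    using N by (simp add: powr_diff powr_nat power_divide)
  have "zeta_term m n s = of_nat N powr (1 - s) * ((1 + of_real (1/N)) powr (1 - s) -
        (\<Sum>i\<le>m. zeta_ff i s / fact i * (of_real (1/N)) ^ i))"
    unfolding zeta_term_def N_def[symmetric] e1 e2
    by (simp add: right_diff_distrib sum_distrib_left mult_ac)
  then have "norm (zeta_term m n s) \<le> norm (of_nat N powr (1 - s)) *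
      (norm (zeta_ff (Suc m) s) * real N powr (- real (Suc m)))"
    unfolding norm_mult using bd by (auto simp: norm_mult intro!: mult_left_mono)
  also have "norm (of_nat N powr (1 - s)) = real N powr (1 - Re s)"
    using N norm_powr_real_powr[of "of_nat N" "1 - s"] by simp
  also have "real N powr (1 - Re s) * (norm (zeta_ff (Suc m) s) * real N powr (- real (Suc m)))
     = norm (zeta_ff (Suc m) s) * real N powr (- Re s - m)"
    by (simp add: algebra_simps flip: powr_add)
  finally show ?thesis by (simp only: N_def)
qed

lemma zeta_error_holomorphic:
  "(\<lambda>s. \<Sum>n. zeta_term m n s) holomorphic_on {s. Re s > 1 - real m}"
proof (rule holomorphic_uniform_sequence)
  show "open {s. 1 - real m < Re s}" by (rule open_halfspace_Re_gt)
  show "(\<lambda>s. \<Sum>n<k. zeta_term m n s) holomorphic_on {s. 1 - real m < Re s}" for k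
    by (intro holomorphic_intros zeta_term_holomorphic)
  fix x assume "x \<in> {s. 1 - real m < Re s}"
  then have x: "Re x > 1 - real m" by simp
  define d where "d = (Re x - (1 - real m)) / 2"
  have d: "d > 0" using x by (simp add: d_def)
  have re: "Re y \<ge> 1 - real m + d" if "y \<in> cball x d" for y
  proof -
    have "\<bar>Re x - Re y\<bar> \<le> d"
      using that abs_Re_le_cmod[of "x - y"] by (simp add: dist_norm)
    then have "Re y \<ge> Re x - d" by linarith
    then show ?thesis by (simp add: d_def field_simps)
  qed
  have "compact (zeta_ff (Suc m) ` cball x d)"
    by (intro compact_continuous_image holomorphic_on_imp_continuous_on zeta_ff_holomorphic) auto
  then obtain B where B: "\<And>y. y \<in> cball x d \<Longrightarrow> norm (zeta_ff (Suc m) y) \<le> B"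
    using compact_imp_bounded bounded_iff by (metis imageI)
  have "uniform_limit (cball x d) (\<lambda>k s. \<Sum>n<k. zeta_term m n s) (\<lambda>s. \<Sum>n. zeta_term m n s) sequentially"
  proof (rule Weierstrass_m_test)
    show "norm (zeta_term m n y) \<le> B * real (Suc n) powr (- 1 - d)" if y: "y \<in> cball x d" for n y
    proof -
      have "norm (zeta_term m n y) \<le> norm (zeta_ff (Suc m) y) * real (Suc n) powr (- Re y - m)"
        using re[OF y] d by (intro zeta_term_bound) auto
      also have "\<dots> \<le> B * real (Suc n) powr (- 1 - d)"
        using re[OF y] B[OF y] by (intro mult_mono powr_mono) (auto intro: order.trans[OF norm_ge_zero])
      finally show ?thesis .
    qed
    have "summable (\<lambda>n. real n powr (- 1 - d))"
      using d by (simp add: summable_real_powr_iff)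
    then show "summable (\<lambda>n. B * real (Suc n) powr (- 1 - d))"
      by (intro summable_mult) (subst summable_Suc_iff)
  qed
  moreover have "cball x d \<subseteq> {s. 1 - real m < Re s}"
    using re d by force
  ultimately show "\<exists>d>0. cball x d \<subseteq> {s. 1 - real m < Re s} \<and>
      uniform_limit (cball x d) (\<lambda>k s. \<Sum>n<k. zeta_term m n s) (\<lambda>s. \<Sum>n. zeta_term m n s) sequentially"
    using d by blast
qed

lemma zeta_series_summable:
  assumes "Re s > 1"
  shows "summable (\<lambda>n. of_nat (Suc n) powr (- s) :: complex)"
proof (rule summable_norm_cancel)
  have "summable (\<lambda>n. real n powr (- Re s))"
    using assms by (simp add: summable_real_powr_iff)
  then have "summable (\<lambda>n. real (Suc n) powr (- Re s))"
    by (subst summable_Suc_iff)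
  moreover have "norm (of_nat (Suc n) powr (- s) :: complex) = real (Suc n) powr (- Re s)" for n
    using norm_powr_real_powr[of "of_nat (Suc n)" "- s"] by (simp del: of_nat_Suc)
  ultimately show "summable (\<lambda>n. norm (of_nat (Suc n) powr (- s) :: complex))"
    by simp
qed

lemma zeta_error_eq:
  assumes s: "Re s > 1" and m: "m \<ge> 1"
  defines "D \<equiv> \<lambda>s. \<Sum>n. of_nat (Suc n) powr (- s) :: complex"
  shows "(s - 1) * D s = 1 + (\<Sum>n. zeta_term m n s) -
           (\<Sum>i\<in>{2..m}. zeta_ff (i - 1) s / fact i * ((s + of_nat (i - 1) - 1) * D (s + of_nat (i - 1))))"
proof -
  have D: "(\<lambda>n. of_nat (Suc n) powr (- z)) sums D z" if "Re z > 1" for z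
    unfolding D_def using zeta_series_summable[OF that] by (rule summable_sums)
  have "(\<lambda>n. of_nat (Suc n) powr (1 - s) :: complex) \<longlonglongrightarrow> 0"
  proof (rule tendsto_norm_zero_cancel)
    have "(\<lambda>n. real (Suc n) powr (1 - Re s)) \<longlonglongrightarrow> 0"
      using s by (intro tendsto_neg_powr filterlim_compose[OF filterlim_real_sequentially filterlim_Suc]) auto
    moreover have "norm (of_nat (Suc n) powr (1 - s) :: complex) = real (Suc n) powr (1 - Re s)" for n
      using norm_powr_real_powr[of "of_nat (Suc n)" "1 - s"] by (simp del: of_nat_Suc)
    ultimately show "(\<lambda>n. norm (of_nat (Suc n) powr (1 - s) :: complex)) \<longlonglongrightarrow> 0"
      by simp
  qed
  from telescope_sums[OF this]
  have tele: "(\<lambda>n. of_nat (Suc (Suc n)) powr (1 - s) - of_nat (Suc n) powr (1 - s)) sums (-1 :: complex)"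
    by simp
  have "(\<lambda>n. (of_nat (Suc (Suc n)) powr (1 - s) - of_nat (Suc n) powr (1 - s)) -
          (\<Sum>i\<in>{1..m}. zeta_ff i s / fact i * of_nat (Suc n) powr (- (s + of_nat (i - 1)))))
        sums (- 1 - (\<Sum>i\<in>{1..m}. zeta_ff i s / fact i * D (s + of_nat (i - 1))))"
    using s by (intro sums_diff sums_sum sums_mult D tele) auto
  also have "(\<lambda>n. (of_nat (Suc (Suc n)) powr (1 - s) - of_nat (Suc n) powr (1 - s)) -
          (\<Sum>i\<in>{1..m}. zeta_ff i s / fact i * of_nat (Suc n) powr (- (s + of_nat (i - 1)))))
       = (\<lambda>n. zeta_term m n s)"
  proof
    fix n
    have "{..m} = insert 0 {1..m}" by auto
    then have "zeta_term m n s = of_nat (Suc (Suc n)) powr (1 - s) -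
        (of_nat (Suc n) powr (1 - s) +
         (\<Sum>i\<in>{1..m}. zeta_ff i s / fact i * of_nat (Suc n) powr (1 - s - of_nat i)))"
      by (simp add: zeta_term_def zeta_ff_def)
    also have "(\<Sum>i\<in>{1..m}. zeta_ff i s / fact i * of_nat (Suc n) powr (1 - s - of_nat i)) =
       (\<Sum>i\<in>{1..m}. zeta_ff i s / fact i * of_nat (Suc n) powr (- (s + of_nat (i - 1))))"
      by (intro sum.cong refl arg_cong2[of _ _ _ _ "(*)"] arg_cong2[of _ _ _ _ "(powr)"])
         (auto simp: of_nat_diff)
    finally show "(of_nat (Suc (Suc n)) powr (1 - s) - of_nat (Suc n) powr (1 - s)) -
          (\<Sum>i\<in>{1..m}. zeta_ff i s / fact i * of_nat (Suc n) powr (- (s + of_nat (i - 1))))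
        = zeta_term m n s" by simp
  qed
  finally have "(\<Sum>n. zeta_term m n s) =
      - 1 - (\<Sum>i\<in>{1..m}. zeta_ff i s / fact i * D (s + of_nat (i - 1)))"
    by (rule sums_unique[symmetric])
  also have "{1..m} = insert 1 {2..m}" using m by auto
  also have "(\<Sum>i\<in>insert 1 {2..m}. zeta_ff i s / fact i * D (s + of_nat (i - 1))) =
      (1 - s) * D s + (\<Sum>i\<in>{2..m}. zeta_ff i s / fact i * D (s + of_nat (i - 1)))"
    by (simp add: zeta_ff_def)
  also have "(\<Sum>i\<in>{2..m}. zeta_ff i s / fact i * D (s + of_nat (i - 1))) =
     - (\<Sum>i\<in>{2..m}. zeta_ff (i - 1) s / fact i * ((s + of_nat (i - 1) - 1) * D (s + of_nat (i - 1))))"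
    unfolding sum_negf[symmetric]
  proof (intro sum.cong refl)
    fix i assume "i \<in> {2..m}"
    then obtain j where j: "i = Suc j" by (cases i) auto
    have ff: "zeta_ff (Suc j) s = - (zeta_ff j s * (s + of_nat j - 1))"
      by (simp add: zeta_ff_def algebra_simps)
    show "zeta_ff i s / fact i * D (s + of_nat (i - 1)) =
      - (zeta_ff (i - 1) s / fact i * ((s + of_nat (i - 1) - 1) * D (s + of_nat (i - 1))))"
      unfolding j diff_Suc_1 ff by (simp del: fact_Suc)
  qed
  finally show ?thesis by (simp add: algebra_simps)
qed

lemma zeta_continuation_step:
  fixes D :: "complex \<Rightarrow> complex"
  defines "D \<equiv> \<lambda>s. \<Sum>n. of_nat (Suc n) powr (- s)"
  shows "\<exists>g. g holomorphic_on {s. Re s > - real k} \<and> (\<forall>s. Re s > 1 \<longrightarrow> g s = (s - 1) * D s)"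
proof (induction k)
  case 0
  show ?case
    using zeta_error_holomorphic[of 1] zeta_error_eq[of _ 1]
    by (intro exI[of _ "\<lambda>s. 1 + (\<Sum>n. zeta_term 1 n s)"]) (auto simp: D_def intro!: holomorphic_intros)
next
  case (Suc k)
  then obtain g where g: "g holomorphic_on {s. Re s > - real k}"
    and gD: "\<And>s. Re s > 1 \<Longrightarrow> g s = (s - 1) * D s" by blast
  define m where "m = k + 2"
  define h where "h = (\<lambda>s. 1 + (\<Sum>n. zeta_term m n s) -
     (\<Sum>i\<in>{2..m}. zeta_ff (i - 1) s / fact i * g (s + of_nat (i - 1))))"
  have "h holomorphic_on {s. Re s > - real (Suc k)}"
    unfolding h_def
  proof (intro holomorphic_intros zeta_ff_holomorphic)
    show "(\<lambda>s. \<Sum>n. zeta_term m n s) holomorphic_on {s. - real (Suc k) < Re s}"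
      using zeta_error_holomorphic[of m] by (simp add: m_def)
    fix i assume i: "i \<in> {2..m}"
    have "(g \<circ> (\<lambda>s. s + of_nat (i - 1))) holomorphic_on {s. - real (Suc k) < Re s}"
      using i by (intro holomorphic_on_compose_gen[OF _ g] holomorphic_intros) auto
    then show "(\<lambda>s. g (s + of_nat (i - 1))) holomorphic_on {s. - real (Suc k) < Re s}"
      by (simp add: o_def)
  qed auto
  moreover have "h s = (s - 1) * D s" if s: "Re s > 1" for s
  proof -
    have "h s = 1 + (\<Sum>n. zeta_term m n s) -
     (\<Sum>i\<in>{2..m}. zeta_ff (i - 1) s / fact i *
        ((s + of_nat (i - 1) - 1) * D (s + of_nat (i - 1))))"
      unfolding h_def using s by (simp add: gD)
    also have "\<dots> = (s - 1) * D s"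
      using zeta_error_eq[OF s, of m] unfolding D_def by (simp add: m_def)
    finally show ?thesis .
  qed
  ultimately show ?case by blast
qed

lemma is_zeta_continuation_zeta: "is_zeta_continuation zeta"
proof -
  define D :: "complex \<Rightarrow> complex" where "D = (\<lambda>s. \<Sum>n. of_nat (Suc n) powr (- s))"
  have "\<forall>k. \<exists>g. g holomorphic_on {s. Re s > - real k} \<and> (\<forall>s. Re s > 1 \<longrightarrow> g s = (s - 1) * D s)"
    unfolding D_def using zeta_continuation_step by blast
  then obtain g where g: "\<And>k. g k holomorphic_on {s. Re s > - real k}"
    and gD: "\<And>k s. Re s > 1 \<Longrightarrow> g k s = (s - 1) * D s" by metis
  have agree: "g k s = g l s" if "k \<le> l" "Re s > - real k" for k l s
  proof (rule analytic_continuation_open[of "{s. Re s > 1}" "{s. Re s > - real k}" "g k" "g l"])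
    show "{s. 1 < Re s} \<noteq> {}" by (auto intro: exI[of _ 2])
    show "connected {s. Re s > - real k}"
      by (intro convex_connected convex_halfspace_Re_gt)
    show "g l holomorphic_on {s. Re s > - real k}"
      using that by (intro holomorphic_on_subset[OF g[of l]]) auto
  qed (use that g gD in \<open>auto simp: open_halfspace_Re_gt\<close>)
  define N where "N = (\<lambda>s. nat \<lceil>1 - Re s\<rceil>)"
  have N: "Re s > - real (N s)" for s unfolding N_def by linarith
  define G where "G = (\<lambda>s. g (N s) s)"
  have Geq: "G s = g k s" if "Re s > - real k" for s k
    unfolding G_def using agree[OF _ that, of "N s"] agree[OF _ N[of s], of k]
    by (metis nle_le)
  have "G holomorphic_on (\<Union>k. {s. Re s > - real k})"
  proof (rule holomorphic_on_UN_open)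
    show "G holomorphic_on {s. Re s > - real k}" for k
      using g[of k] Geq by (subst holomorphic_cong[OF refl, of _ _ "g k"]) auto
  qed (auto simp: open_halfspace_Re_gt)
  moreover have "(\<Union>k. {s. Re s > - real k}) = UNIV" using N by fast
  ultimately have G: "G holomorphic_on UNIV" by simp
  have "is_zeta_continuation (\<lambda>s. G s / (s - 1))"
    unfolding is_zeta_continuation_def
  proof (intro conjI allI impI)
    show "(\<lambda>s. G s / (s - 1)) holomorphic_on - {1}"
      by (intro holomorphic_intros holomorphic_on_subset[OF G]) auto
    fix s :: complex assume s: "Re s > 1"
    have "G s = (s - 1) * D s" using Geq[of 0 s] gD[of s 0] s by simp
    moreover have "s \<noteq> 1" using s by auto
    ultimately have "G s / (s - 1) = D s" by simp
    then show "(\<lambda>n. of_nat (Suc n) powr (- s)) sums (G s / (s - 1))"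
      using zeta_series_summable[OF s] summable_sums unfolding D_def by metis
  qed
  then show ?thesis unfolding zeta_def by (rule someI[of is_zeta_continuation])
qed

text \<open>
  \<^const>\<open>ln_Gamma\<close> on the complex numbers is holomorphic on the plane slit along the nonpositive reals
  and is real on the positive reals, so its imaginary part along the line \<open>Re z = 1/4\<close> is the
  continuous branch that vanishes at \<open>1/4\<close>. (Composing the principal logarithm with \<open>Gamma\<close>
  would not be continuous.)
\<close>
definition RS_theta :: "real \<Rightarrow> real" where
  "RS_theta t = - t / 2 * ln pi + Im (ln_Gamma (1 / 4 + \<i> * of_real (t / 2)))"

lemma RS_theta_0: "RS_theta 0 = 0"
proof -
  have "ln_Gamma (complex_of_real (1 / 4)) = of_real (ln_Gamma (1 / 4))"
    by (rule ln_Gamma_complex_of_real) auto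
  then show ?thesis by (simp add: RS_theta_def)
qed

lemma continuous_RS_theta: "continuous_on UNIV RS_theta"
  unfolding RS_theta_def
  by (intro continuous_intros continuous_on_compose2[OF holomorphic_on_imp_continuous_on[OF
        holomorphic_ln_Gamma[of "{z. Re z > 0}"]]])
     (auto simp: complex_nonpos_Reals_iff)

lemma RS_theta_lower_bound:
  assumes t: "t \<ge> 0"
  shows "RS_theta t \<ge> t / 2 * (harm m - euler_mascheroni - ln pi) - pi / 2 * (real m + 1)"
proof -
  define y where "y = t / 2"
  have y: "y \<ge> 0" using t by (simp add: y_def)
  define z where "z = Complex (1/4) y"
  have z_eq: "1 / 4 + \<i> * of_real (t / 2) = z"
    by (simp add: z_def y_def complex_eq_iff)
  have "z \<notin> \<int>\<^sub>\<le>\<^sub>0" by (auto simp: z_def complex_eq_iff elim!: nonpos_Ints_cases)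
  then have lim: "(\<lambda>n. Im (ln_Gamma_series z n)) \<longlonglongrightarrow> Im (ln_Gamma z)"
    by (intro tendsto_Im ln_Gamma_complex_LIMSEQ)
  have Im_ln_z: "Im (ln z) \<le> pi / 2"
    using Re_Ln_pos_lt_imp[of z] by (simp add: z_def)
  have Im_ln_k: "Im (ln (z / of_nat k + 1)) \<le> pi / 2" "Im (ln (z / of_nat k + 1)) \<le> y / real k"
    if k: "k \<ge> 1" for k
  proof -
    define w where "w = z / of_nat k + 1"
    have re: "Re w \<ge> 1" and im: "Im w = y / real k" by (simp_all add: w_def z_def)
    show "Im (ln (z / of_nat k + 1)) \<le> pi / 2"
      using Re_Ln_pos_lt_imp[of w] re by (simp add: w_def)
    have "w \<noteq> 0" using re by auto
    then have "Im (ln w) = arctan (Im w / Re w)"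
      using re Im_Ln_eq by simp
    also have "\<dots> \<le> Im w / Re w"
      using re im y by (intro arctan_le_self) auto
    also have "\<dots> \<le> Im w"
      using divide_left_mono[OF re, of "Im w"] re im y by simp
    also note im
    finally show "Im (ln (z / of_nat k + 1)) \<le> y / real k"
      by (simp only: w_def)
  qed
  have "y * (harm m - euler_mascheroni) - pi / 2 * (real m + 1) \<le> Im (ln_Gamma z)"
  proof (rule tendsto_le[OF _ lim])
    show "(\<lambda>n. y * (harm m - (harm n - ln (of_nat n))) - pi / 2 * (real m + 1)) \<longlonglongrightarrow>
            y * (harm m - euler_mascheroni) - pi / 2 * (real m + 1)"
      by (intro tendsto_intros euler_mascheroni_LIMSEQ)
    show "\<forall>\<^sub>F n in sequentially. y * (harm m - (harm n - ln (of_nat n))) - pi / 2 * (real m + 1)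
            \<le> Im (ln_Gamma_series z n)"
      using eventually_ge_at_top[of "Suc m"]
    proof eventually_elim
      case (elim n)
      have split: "{1..n} = {1..m} \<union> {m+1..n}" "{1..m} \<inter> {m+1..n} = {}" using elim by auto
      have "(\<Sum>k=1..n. Im (ln (z / of_nat k + 1))) =
          (\<Sum>k=1..m. Im (ln (z / of_nat k + 1))) + (\<Sum>k=m+1..n. Im (ln (z / of_nat k + 1)))"
        unfolding split(1) by (rule sum.union_disjoint) auto
      also have "\<dots> \<le> (\<Sum>k=1..m. pi / 2) + (\<Sum>k=m+1..n. y / real k)"
        by (intro add_mono sum_mono Im_ln_k) auto
      also have "(\<Sum>k=m+1..n. y / real k) = y * (harm n - harm m)"
      proof -
        have "(harm n :: real) = harm m + (\<Sum>k=m+1..n. inverse (real k))"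
          unfolding harm_def split(1) by (rule sum.union_disjoint) auto
        then show ?thesis by (simp add: sum_distrib_left divide_inverse)
      qed
      finally have "(\<Sum>k=1..n. Im (ln (z / of_nat k + 1))) \<le> real m * (pi / 2) + y * (harm n - harm m)"
        by simp
      moreover have "Im (z * ln (of_nat n)) = y * ln (real n)"
        using elim by (simp add: z_def Ln_of_nat)
      moreover have "Im (ln_Gamma_series z n) = Im (z * ln (of_nat n)) - Im (ln z) -
          (\<Sum>k=1..n. Im (ln (z / of_nat k + 1)))"
        by (simp add: ln_Gamma_series_def Im_sum)
      moreover have "pi / 2 * (real m + 1) = real m * (pi / 2) + pi / 2"
        by (simp add: algebra_simps)
      ultimately show ?case
        using Im_ln_z right_diff_distrib[of y "harm n" "harm m"]
          right_diff_distrib[of y "harm m" "harm n - ln (real n)"]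
          right_diff_distrib[of y "harm n" "ln (real n)"]
        by linarith
    qed
  qed auto
  then show ?thesis
    unfolding RS_theta_def z_eq
    using right_diff_distrib[of "t / 2" "harm m - euler_mascheroni" "ln pi"]
    by (simp add: y_def diff_divide_distrib)
qed

lemma filterlim_RS_theta: "filterlim RS_theta at_top at_top"
proof -
  have "\<forall>\<^sub>F m in sequentially. (harm m :: real) \<ge> euler_mascheroni + ln pi + 2"
    using harm_at_top by (simp add: filterlim_at_top)
  then obtain m where m: "(harm m :: real) \<ge> euler_mascheroni + ln pi + 2"
    by (auto simp: eventually_sequentially)
  show ?thesis
  proof (rule filterlim_at_top_mono)
    show "filterlim (\<lambda>t::real. - (pi / 2 * (real m + 1)) + t) at_top at_top"
      by (intro filterlim_tendsto_add_at_top[OF tendsto_const] filterlim_ident)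
    show "\<forall>\<^sub>F t in at_top. - (pi / 2 * (real m + 1)) + t \<le> RS_theta t"
      using eventually_ge_at_top[of 0]
    proof eventually_elim
      case (elim t)
      have "t / 2 * 2 \<le> t / 2 * (harm m - euler_mascheroni - ln pi)"
        using elim m by (intro mult_left_mono) auto
      then show ?case using RS_theta_lower_bound[OF elim, of m] by simp
    qed
  qed
qed

definition hardy_Z :: "real \<Rightarrow> complex" where
  "hardy_Z t = cis (RS_theta t) * zeta (1 / 2 + \<i> * of_real t)"

text \<open>
  The equation \<open>\<theta>(t) = \<pi>\<nu> + \<tau>\<close> can have several real solutions, because \<open>\<theta>\<close> is odd and decreasing near
  the origin; the large solution is the greatest one. It exists by the lemma \<open>gram_t\<close> below.
\<close>
definition gram_t :: "int \<Rightarrow> real \<Rightarrow> real" where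
  "gram_t \<nu> \<tau> = (GREATEST t. RS_theta t = pi * of_int \<nu> + \<tau>)"

lemma gram_t:
  assumes "pi * of_int \<nu> + \<tau> \<ge> 0"
  shows   "RS_theta (gram_t \<nu> \<tau>) = pi * of_int \<nu> + \<tau>"
    and   "RS_theta t = pi * of_int \<nu> + \<tau> \<Longrightarrow> t \<le> gram_t \<nu> \<tau>"
proof -
  define y where "y = pi * of_int \<nu> + \<tau>"
  define A where "A = {t. 0 \<le> t \<and> RS_theta t = y}"
  have "\<forall>\<^sub>F t in at_top. RS_theta t \<ge> y + 1"
    using filterlim_RS_theta by (simp add: filterlim_at_top)
  then obtain B where B: "\<And>t. t \<ge> B \<Longrightarrow> RS_theta t \<ge> y + 1"
    by (auto simp: eventually_at_top_linorder)
  have "\<exists>t\<ge>0. t \<le> max 0 B \<and> RS_theta t = y"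
  proof (rule IVT')
    show "RS_theta 0 \<le> y" using assms by (simp add: RS_theta_0 y_def)
    show "y \<le> RS_theta (max 0 B)" using B[of "max 0 B"] by simp
    show "continuous_on {0..max 0 B} RS_theta"
      using continuous_RS_theta by (rule continuous_on_subset) auto
  qed auto
  then have "A \<noteq> {}" by (auto simp: A_def)
  moreover have "compact A"
  proof -
    have "closed (RS_theta -` {y})"
      using continuous_RS_theta by (intro closed_vimage) auto
    moreover have "A = RS_theta -` {y} \<inter> {0..B}"
    proof -
      have "t \<le> B" if "RS_theta t = y" for t
        using B[of t] that by linarith
      then show ?thesis by (auto simp: A_def)
    qed
    ultimately show ?thesis by (simp add: closed_Int_compact)
  qed
  ultimately obtain u where u: "u \<in> A" "\<And>t. t \<in> A \<Longrightarrow> t \<le> u"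
    using compact_attains_sup by metis
  have u_max: "t \<le> u" if "RS_theta t = y" for t
    using u(1) u(2)[of t] that by (cases "t \<ge> 0") (auto simp: A_def)
  have "gram_t \<nu> \<tau> = u"
    unfolding gram_t_def y_def[symmetric]
    using u(1) u_max by (intro Greatest_equality) (auto simp: A_def)
  then show "RS_theta (gram_t \<nu> \<tau>) = pi * of_int \<nu> + \<tau>"
    and "RS_theta t = pi * of_int \<nu> + \<tau> \<Longrightarrow> t \<le> gram_t \<nu> \<tau>"
    using u(1) u_max by (auto simp: A_def y_def)
qed

definition F_sum :: "int \<Rightarrow> real \<Rightarrow> real \<Rightarrow> real \<Rightarrow> complex" where
  "F_sum \<nu>\<^sub>0 \<tau> T H =
     (\<Sum>\<nu> | \<nu> \<ge> \<nu>\<^sub>0 \<and> gram_t \<nu> 0 \<in> {T..T + H}. hardy_Z (gram_t \<nu> \<tau>))"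

definition lindelof_hypothesis :: bool where
  "lindelof_hypothesis \<longleftrightarrow> (\<forall>\<delta>>0.
     (\<lambda>t::real. zeta (1 / 2 + \<i> * of_real t)) \<in> O[at_top](\<lambda>t. of_real (t powr \<delta>)))"

end

theory Submission
  imports Defs "HOL-Real_Asymp.Real_Asymp"
begin

text \<open>
  Extend \<open>Z\<close> holomorphically by \<open>Z t = exp (\<i> \<theta> t) * zeta (1/2 + \<i> t)\<close> and put \<open>w = exp (- 2 \<i> (\<theta> - \<tau>))\<close>.
  The points \<open>t\<^sub>\<nu>(\<tau>)\<close> are the zeros of \<open>1 - w\<close>, so \<open>\<pi> \<Sum> Z (t\<^sub>\<nu>(\<tau>))\<close> is the integral of
  \<open>\<theta>' Z / (1 - w)\<close> around a rectangle \<open>\<bar>Im t\<bar> \<le> 3\<close>. As \<open>\<bar>w\<bar>\<close> is about \<open>t powr Im t\<close>, the kernel is close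
  to \<open>1\<close> below the real axis and to \<open>0\<close> above it. Hence the sum equals \<open>\<integral> \<theta>' Z\<close> over a real interval, which
  depends on \<open>\<tau>\<close> only through its end points, up to the integrals of \<open>\<theta>' Z w / (1 - w)\<close> below and of
  \<open>\<theta>' Z / (1 - w)\<close> above the axis. On the horizontal sides these are \<open>O(t powr (-1/6))\<close>, and on the vertical
  ones the Lindelof bound, interpolated into the strip, makes them \<open>O(t powr \<epsilon>)\<close>. No functional equation is
  needed: to the left of the critical line a crude polynomial bound for zeta is beaten by the decay of \<open>1 / w\<close>.
\<close>

section \<open>Growth of the zeta function\<close>

text \<open>The height 3 comes from a balance. At height v above the axis the integrand carries the
  factor x^(-3v/2): exp (\<i> \<theta>) contributes x^(-v/2) and 1/w contributes x^(-v). For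
  integral v the crude bound for zeta at abscissa 1/2 - v costs x^(1+v), so x^(1-v/2) remains, up to
  the logarithm in \<theta>'; v = 3 leaves x^(-1/2). The exponent -1/6 is what the length of the
  horizontal sides, about T^(1/6+\<epsilon>), asks for.

  The vertical sides cannot stand at T and T + H, which may be close to zeros of 1 - w. They stand
  at real points where the phase is -1, half a step outside the first and the last index. The
  indices are selected at \<tau> = 0 and so do not depend on \<tau>, while the end points move with
  \<tau>, by a bounded amount since \<theta>' \<ge> 1. For large \<epsilon> the interval may be
  longer than T, so the growth exponent on the vertical sides has to be chosen smaller than
  \<epsilon>.\<close>

lemma zeta_holomorphic: "zeta holomorphic_on - {1}"
  using is_zeta_continuation_zeta by (simp add: is_zeta_continuation_def)

lemma zeta_sums:
  assumes "Re s > 1"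
  shows   "(\<lambda>n. of_nat (Suc n) powr (- s)) sums zeta s"
  using is_zeta_continuation_zeta assms by (simp add: is_zeta_continuation_def)

lemma norm_of_nat_powr: "n > 0 \<Longrightarrow> norm (of_nat n powr z :: complex) = real n powr Re z"
  using norm_powr_real_powr[of "of_nat n" z] by simp

lemma summable_Suc_powr:
  assumes "a < -1"
  shows "summable (\<lambda>n. real (Suc n) powr a)"
  using assms by (subst summable_Suc_iff) (simp add: summable_real_powr_iff)

lemma zeta_bounded_right:
  assumes "1 < c" "c \<le> Re s"
  shows "norm (zeta s) \<le> (\<Sum>n. real (Suc n) powr (- c))"
proof -
  have s: "Re s > 1" using assms by simp
  have nrm: "norm (of_nat (Suc n) powr (- s) :: complex) = real (Suc n) powr (- Re s)" for n
    using norm_of_nat_powr[of "Suc n" "-s"] by (simp del: of_nat_Suc)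
  have "zeta s = (\<Sum>n. of_nat (Suc n) powr (- s))"
    using zeta_sums[OF s] by (rule sums_unique)
  also have "norm \<dots> \<le> (\<Sum>n. real (Suc n) powr (- c))"
  proof (rule norm_suminf_le)
    show "norm (of_nat (Suc n) powr (- s) :: complex) \<le> real (Suc n) powr (- c)" for n
      unfolding nrm using assms by (intro powr_mono) auto
  qed (use assms summable_Suc_powr in auto)
  finally show ?thesis .
qed

text \<open>\<open>zeta_error_eq\<close> lives where the Dirichlet series converges, and both sides
  continue analytically. The region is convex, hence connected, and Im s > 0 keeps s and all its
  shifts s + k off the pole.\<close>

lemma zeta_recursion:
  assumes m: "m \<ge> 1" and s: "Re s > 1 - real m" "Im s > 0"
  shows "(s - 1) * zeta s = 1 + (\<Sum>n. zeta_term m n s) -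
           (\<Sum>i\<in>{2..m}. zeta_ff (i - 1) s / fact i * ((s + of_nat (i - 1) - 1) * zeta (s + of_nat (i - 1))))"
proof -
  let ?L = "\<lambda>s. (s - 1) * zeta s"
  let ?R = "\<lambda>s. 1 + (\<Sum>n. zeta_term m n s) -
           (\<Sum>i\<in>{2..m}. zeta_ff (i - 1) s / fact i * ((s + of_nat (i - 1) - 1) * zeta (s + of_nat (i - 1))))"
  let ?S = "{s. Re s > 1 - real m} \<inter> {s. Im s > 0}"
  let ?U = "{s. Re s > 1} \<inter> {s. Im s > 0}"
  have shift: "(\<lambda>s. zeta (s + of_nat k)) holomorphic_on ?S" for k
  proof -
    have "(zeta \<circ> (\<lambda>s. s + of_nat k)) holomorphic_on ?S"
      by (rule holomorphic_on_compose_gen[OF _ zeta_holomorphic])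
         (auto intro!: holomorphic_intros simp: complex_eq_iff)
    then show ?thesis by (simp add: o_def)
  qed
  show ?thesis
  proof (rule analytic_continuation_open[of ?U ?S ?L ?R])
    show "open ?U" "open ?S"
      by (intro open_Int open_halfspace_Re_gt open_halfspace_Im_gt)+
    have "Complex 2 1 \<in> ?U" by simp
    then show "?U \<noteq> {}" by blast
    show "connected ?S"
      by (intro convex_connected convex_Int convex_halfspace_Re_gt convex_halfspace_Im_gt)
    show "?U \<subseteq> ?S" by auto
    show "?L holomorphic_on ?S"
      using shift[of 0] by (auto intro!: holomorphic_intros)
    show "?R holomorphic_on ?S"
      by (intro holomorphic_intros shift zeta_ff_holomorphic
            holomorphic_on_subset[OF zeta_error_holomorphic[of m]]) auto
    show "?L z = ?R z" if "z \<in> ?U" for z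
    proof -
      have z: "Re z > 1" using that by simp
      define D :: "complex \<Rightarrow> complex" where "D = (\<lambda>w. \<Sum>n. of_nat (Suc n) powr (- w))"
      have D: "(\<Sum>n. of_nat (Suc n) powr (- w)) = D w" for w by (simp add: D_def)
      have Z: "D w = zeta w" if "Re w > 1" for w
        unfolding D_def using zeta_sums[OF that] by (rule sums_unique[symmetric])
      show ?thesis
        using zeta_error_eq[OF z m] z unfolding D by (simp add: Z)
    qed
    show "s \<in> ?S" using s by simp
  qed
qed

text \<open>Since |s| \<ge> 1, the factor with index k is at most (k + 2) * |s|, and the product of
  k + 2 over k < i is (i + 1)!.\<close>

lemma zeta_ff_bound:
  assumes "Im s \<ge> 1"
  shows "norm (zeta_ff i s) \<le> fact (Suc i) * norm s ^ i"
proof (induction i)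
  case (Suc i)
  have s: "norm s \<ge> 1" using assms abs_Im_le_cmod[of s] by linarith
  have "norm (1 - s - of_nat i) \<le> norm (1 - s) + real i"
    by (rule norm_triangle_le_diff) simp
  also have "norm (1 - s) \<le> 1 + norm s"
    by (rule norm_triangle_le_diff) simp
  also have "1 + norm s + real i \<le> real (Suc (Suc i)) * norm s"
    using s mult_left_mono[OF s, of "real i + 1"] by (simp add: algebra_simps)
  finally have "norm (zeta_ff i s) * norm (1 - s - of_nat i) \<le>
      (fact (Suc i) * norm s ^ i) * (real (Suc (Suc i)) * norm s)"
    by (intro mult_mono Suc.IH) auto
  then show ?case by (simp add: zeta_ff_def norm_mult mult_ac)
qed (simp add: zeta_ff_def)

lemma norm_le_double_minus_1:
  assumes "Im s \<ge> 1"
  shows "norm s \<le> 2 * norm (s - 1)"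
proof -
  have "1 \<le> norm (s - 1)" using assms abs_Im_le_cmod[of "s - 1"] by simp
  moreover have "norm s \<le> norm (s - 1) + 1"
    using norm_triangle_ineq[of "s - 1" 1] by simp
  ultimately show ?thesis by simp
qed

text \<open>\<open>zeta_recursion\<close> expresses (s - 1) * zeta s through the values at s + 1,
  ..., s + m - 1, for which smaller exponents are already known. Every term is O(|s|^(m+1)), and
  dividing by s - 1 saves one power. The offset 3/2 keeps the exponent of the error series at most
  -3/2.\<close>

lemma zeta_polynomial_growth:
  "\<exists>C\<ge>0. \<forall>s. Re s \<ge> 3/2 - real m \<longrightarrow> Im s \<ge> 1 \<longrightarrow> norm (zeta s) \<le> C * norm s ^ m"
proof (induction m rule: less_induct)
  case (less m)
  define K where "K = (\<Sum>n. real (Suc n) powr (- (3/2)))"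
  have K: "K \<ge> 0" unfolding K_def by (intro suminf_nonneg summable_Suc_powr) auto
  show ?case
  proof (cases "m = 0")
    case True
    then show ?thesis using zeta_bounded_right[of "3/2"] K
      by (intro exI[of _ K]) (auto simp: K_def)
  next
    case False
    obtain C where C: "\<And>k. k < m \<Longrightarrow> C k \<ge> 0"
      "\<And>k s. k < m \<Longrightarrow> Re s \<ge> 3/2 - real k \<Longrightarrow> Im s \<ge> 1 \<Longrightarrow> norm (zeta s) \<le> C k * norm s ^ k"
      using less by metis
    \<comment> \<open>The summands collect the coefficients of |s|^(m+1) from the constant 1, the
      error series and the shifted values.\<close>
    define E where "E = 1 + fact (m + 2) * K + (\<Sum>i\<in>{2..m}. fact i * (real i * (C (m + 1 - i) * real i ^ (m + 1 - i))))"
    have "norm (zeta s) \<le> (2 * E) * norm s ^ m" if s: "Re s \<ge> 3/2 - real m" "Im s \<ge> 1" for s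
    proof -
      have s1: "norm s \<ge> 1" using s abs_Im_le_cmod[of s] by linarith
      have "norm (\<Sum>n. zeta_term m n s) \<le> (\<Sum>n. fact (m+2) * norm s ^ (m+1) * real (Suc n) powr (- (3/2)))"
      proof (rule norm_suminf_le)
        fix n
        have "norm (zeta_term m n s) \<le> norm (zeta_ff (Suc m) s) * real (Suc n) powr (- Re s - m)"
          using s by (intro zeta_term_bound) auto
        also have "\<dots> \<le> (fact (m+2) * norm s ^ (m+1)) * real (Suc n) powr (- (3/2))"
          using s zeta_ff_bound[OF s(2), of "Suc m"] by (intro mult_mono powr_mono) auto
        finally show "norm (zeta_term m n s) \<le> fact (m+2) * norm s ^ (m+1) * real (Suc n) powr (- (3/2))" .
      qed (intro summable_mult summable_Suc_powr, simp)
      also have "\<dots> = fact (m+2) * norm s ^ (m+1) * K"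
        unfolding K_def by (intro suminf_mult summable_Suc_powr) simp
      finally have 1: "norm (\<Sum>n. zeta_term m n s) \<le> fact (m+2) * K * norm s ^ (m+1)" by (simp add: mult_ac)
      have 2: "norm (zeta_ff (i - 1) s / fact i * ((s + of_nat (i - 1) - 1) * zeta (s + of_nat (i - 1))))
         \<le> fact i * (real i * (C (m + 1 - i) * real i ^ (m + 1 - i))) * norm s ^ (m+1)"
        if i: "i \<in> {2..m}" for i
      proof -
        obtain j where j: "i = Suc j" "j \<ge> 1" using i by (cases i) auto
        have jm: "j \<le> m" "Suc j \<le> m" using i j by auto
        have "norm (s + of_nat j) \<le> norm s + real j"
          by (rule norm_triangle_le) simp
        also have "\<dots> \<le> real (Suc j) * norm s"
          using s1 mult_left_mono[OF s1, of "real j"] by (simp add: algebra_simps)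
        finally have n1: "norm (s + of_nat j) \<le> real (Suc j) * norm s" .
        have "s + of_nat j - 1 = s + of_nat (j - 1)" using j by simp
        also have "norm \<dots> \<le> norm s + real (j - 1)"
          by (rule norm_triangle_le) simp
        also have "\<dots> \<le> norm s + real j" by simp
        also have "\<dots> \<le> real (Suc j) * norm s"
          using s1 mult_left_mono[OF s1, of "real j"] by (simp add: algebra_simps)
        finally have n2: "norm (s + of_nat j - 1) \<le> real (Suc j) * norm s" .
        have "norm (zeta (s + of_nat j)) \<le> C (m - j) * norm (s + of_nat j) ^ (m - j)"
          using s jm j by (intro C) auto
        also have "\<dots> \<le> C (m - j) * (real (Suc j) * norm s) ^ (m - j)"
          using jm j n1 by (intro mult_left_mono power_mono C) auto
        finally have n3: "norm (zeta (s + of_nat j)) \<le> C (m - j) * (real (Suc j) * norm s) ^ (m - j)" .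
        have n0: "norm (zeta_ff j s / fact i) \<le> fact (Suc j) * norm s ^ j"
        proof -
          have "norm (zeta_ff j s / fact i) \<le> norm (zeta_ff j s)"
            using divide_left_mono[OF fact_ge_1[of i, where ?'a = real], of "norm (zeta_ff j s)"]
            by (simp add: norm_divide)
          also note zeta_ff_bound[OF s(2)]
          finally show ?thesis .
        qed
        have "norm (zeta_ff j s / fact i * ((s + of_nat j - 1) * zeta (s + of_nat j)))
          \<le> (fact (Suc j) * norm s ^ j) * ((real (Suc j) * norm s) * (C (m - j) * (real (Suc j) * norm s) ^ (m - j)))"
          unfolding norm_mult[of _ "_ * _"] norm_mult[of "_ - _"] using n0 n2 n3
          by (intro mult_mono n0 n2 n3) (auto simp del: fact_Suc)
        also have "\<dots> = fact i * (real i * (C (m + 1 - i) * real i ^ (m + 1 - i))) * (norm s ^ j * norm s * norm s ^ (m - j))"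
          unfolding j by (simp add: power_mult_distrib mult_ac del: fact_Suc)
        also have "norm s ^ j * norm s * norm s ^ (m - j) = norm s ^ (m + 1)"
          using jm by (simp add: mult_ac flip: power_add power_Suc)
        finally show ?thesis by (simp only: j diff_Suc_1)
      qed
      have "norm s * norm (zeta s) \<le> 2 * norm ((s - 1) * zeta s)"
        using mult_right_mono[OF norm_le_double_minus_1[OF s(2)], of "norm (zeta s)"]
        by (simp add: norm_mult)
      also have "norm ((s - 1) * zeta s) \<le> 1 + fact (m+2) * K * norm s ^ (m+1) +
          (\<Sum>i\<in>{2..m}. fact i * (real i * (C (m + 1 - i) * real i ^ (m + 1 - i))) * norm s ^ (m+1))"
      proof -
        have rec: "(s - 1) * zeta s = 1 + (\<Sum>n. zeta_term m n s) -
           (\<Sum>i\<in>{2..m}. zeta_ff (i - 1) s / fact i * ((s + of_nat (i - 1) - 1) * zeta (s + of_nat (i - 1))))"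
          using False s by (intro zeta_recursion) auto
        have 3: "norm ((s - 1) * zeta s) \<le> norm (1 + (\<Sum>n. zeta_term m n s)) +
           norm (\<Sum>i\<in>{2..m}. zeta_ff (i - 1) s / fact i * ((s + of_nat (i - 1) - 1) * zeta (s + of_nat (i - 1))))"
          unfolding rec by (rule norm_triangle_ineq4)
        have "norm (1 + (\<Sum>n. zeta_term m n s)) \<le> 1 + fact (m+2) * K * norm s ^ (m+1)"
          using norm_triangle_ineq[of 1 "\<Sum>n. zeta_term m n s"] 1 unfolding norm_one by linarith
        moreover have "norm (\<Sum>i\<in>{2..m}. zeta_ff (i - 1) s / fact i * ((s + of_nat (i - 1) - 1) * zeta (s + of_nat (i - 1))))
            \<le> (\<Sum>i\<in>{2..m}. fact i * (real i * (C (m + 1 - i) * real i ^ (m + 1 - i))) * norm s ^ (m+1))"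
          by (intro sum_norm_le 2)
        ultimately show ?thesis using 3 by linarith
      qed
      also have "\<dots> \<le> E * norm s ^ (m + 1)"
        using one_le_power[OF s1, of "m+1"] unfolding E_def sum_distrib_right[symmetric]
        by (simp add: distrib_right)
      finally have "norm s * norm (zeta s) \<le> norm s * (2 * E * norm s ^ m)"
        by (simp add: mult_ac)
      then show ?thesis using s1 by (subst (asm) mult_le_cancel_left_pos) auto
    qed
    moreover have "E \<ge> 0"
      unfolding E_def using K C by (intro add_nonneg_nonneg sum_nonneg mult_nonneg_nonneg) auto
    ultimately show ?thesis by (intro exI[of _ "2 * E"]) auto
  qed
qed

section \<open>Interpolation between vertical lines\<close>

lemma powr_comparable:
  fixes t u e :: real
  assumes "t > 0" "t / 2 \<le> u" "u \<le> 2 * t"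
  shows "u powr e \<le> 2 powr \<bar>e\<bar> * t powr e"
proof -
  have u: "u > 0" "u / t \<le> 2" "t / u \<le> 2"
    using assms by (auto simp: field_simps)
  have "(u / t) powr e \<le> 2 powr \<bar>e\<bar>"
  proof (cases "e \<ge> 0")
    case True
    then show ?thesis using u assms by (auto intro!: powr_mono2)
  next
    case False
    have "(u / t) powr e = (t / u) powr (-e)"
      using u(1) assms(1) by (simp add: powr_divide powr_minus_divide)
    also have "\<dots> \<le> 2 powr (-e)"
      using u assms False by (intro powr_mono2) auto
    finally show ?thesis using False by simp
  qed
  moreover have "u powr e = (u / t) powr e * t powr e"
    using u(1) assms(1) by (simp add: powr_divide)
  ultimately show ?thesis by (simp add: mult_right_mono)
qed

text \<open>
  A localised form of the Phragmen-Lindelof principle: the factor \<open>exp ((s - s0)\<^sup>2)\<close> makes the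
  horizontal sides of a rectangle of height comparable to \<open>Im s0\<close> negligible.
\<close>
lemma strip_interpolation:
  fixes f :: "complex \<Rightarrow> complex" and a b \<kappa> \<delta> M C T :: real and k :: nat
  assumes hol: "f holomorphic_on {s. Im s > 0}"
    and growth: "\<And>s. a \<le> Re s \<Longrightarrow> Im s \<ge> 1 \<Longrightarrow> norm (f s) \<le> M * norm s ^ k"
    and C: "C \<ge> 0"
    and left: "\<And>t. t \<ge> T \<Longrightarrow> norm (f (Complex a t)) \<le> C * t powr (\<delta> - \<kappa> * a)"
    and right: "\<And>t. t \<ge> T \<Longrightarrow> norm (f (Complex b t)) \<le> C * t powr (\<delta> - \<kappa> * b)"
  shows "\<exists>C'. \<forall>\<^sub>F t in at_top. \<forall>\<sigma>\<in>{a..b}. norm (f (Complex \<sigma> t)) \<le> C' * t powr (\<delta> - \<kappa> * \<sigma>)"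
proof -
  define c where "c = \<bar>a\<bar> + \<bar>b\<bar>"
  define d where "d = \<bar>\<kappa>\<bar> * c"
  \<comment> \<open>On the horizontal sides |Im s - t| = t/2. There the Gaussian factor exp (-t^2/4)
    outweighs both the polynomial growth of f and the weight t^(\<kappa> Re s) \<le> t^d.\<close>
  have "((\<lambda>t. \<bar>M\<bar> * (2 * t + c) ^ k * (t powr (d - \<delta>) * exp (-(t\<^sup>2 / 4)))) \<longlongrightarrow> 0) at_top"
    by real_asymp
  then have ev: "\<forall>\<^sub>F t in at_top. \<bar>M\<bar> * (2 * t + c) ^ k * (t powr (d - \<delta>) * exp (-(t\<^sup>2 / 4))) < 1"
    by (rule order_tendstoD) simp
  define e1 e2 where "e1 = \<delta> - \<kappa> * a" and "e2 = \<delta> - \<kappa> * b"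
  define E where "E = exp ((b - a)\<^sup>2)"
  define C' where "C' = E * (C * 2 powr \<bar>e1\<bar> + C * 2 powr \<bar>e2\<bar> + 1)"
  have parts: "E * (C * 2 powr \<bar>e1\<bar>) \<le> C'" "E * (C * 2 powr \<bar>e2\<bar>) \<le> C'" "E \<le> C'"
    using C by (auto simp: C'_def E_def)
  have "\<forall>\<^sub>F t in at_top. \<forall>\<sigma>\<in>{a..b}. norm (f (Complex \<sigma> t)) \<le> C' * t powr (\<delta> - \<kappa> * \<sigma>)"
    using ev eventually_ge_at_top[of 2] eventually_ge_at_top[of "2 * T"]
  proof eventually_elim
    case (elim t)
    have t: "t > 0" using elim by simp
    show ?case
    proof
      fix \<sigma> assume \<sigma>: "\<sigma> \<in> {a..b}"
      \<comment> \<open>The factor t^(\<kappa> s), with t frozen at the height of the target point,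
        levels the exponent \<delta> - \<kappa> * Re s, which is linear in Re s, to \<delta> on both
        vertical sides. \<open>powr_comparable\<close> accounts for heights between t/2 and
        3t/2.\<close>
      define G where "G = (\<lambda>s. f s * exp (of_real (\<kappa> * ln t) * s + (s - Complex \<sigma> t)\<^sup>2))"
      define S where "S = cbox (Complex a (t/2)) (Complex b (3*t/2))"
      have S: "S \<subseteq> {s. Im s > 0}" using t by (auto simp: S_def in_cbox_complex_iff)
      have nG: "norm (G s) = norm (f s) * (t powr (\<kappa> * Re s) * exp ((Re s - \<sigma>)\<^sup>2 - (Im s - t)\<^sup>2))" for s
        using t by (simp add: G_def norm_mult exp_add powr_def mult_ac Re_power2 exp_diff)
      have "norm (G (Complex \<sigma> t)) \<le> C' * t powr \<delta>"
      proof (rule maximum_modulus_frontier[of G S])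
        have holG: "G holomorphic_on {s. Im s > 0}"
          unfolding G_def by (intro holomorphic_intros hol)
        show "G holomorphic_on interior S"
          by (rule holomorphic_on_subset[OF holG]) (use S interior_subset in blast)
        show "continuous_on (closure S) G"
          using holomorphic_on_imp_continuous_on[OF holG] S
          by (simp add: S_def continuous_on_subset)
        show "bounded S" by (simp add: S_def bounded_cbox)
        show "Complex \<sigma> t \<in> S" using \<sigma> t by (auto simp: S_def in_cbox_complex_iff)
        fix z assume "z \<in> frontier S"
        then have z: "Re z \<in> {a..b}" "Im z \<in> {t/2..3*t/2}"
          "Re z = a \<or> Re z = b \<or> \<bar>Im z - t\<bar> = t / 2"
          using t unfolding S_def frontier_cbox
          by (auto simp: in_cbox_complex_iff in_box_complex_iff)
        have sq: "exp ((Re z - \<sigma>)\<^sup>2) \<le> E"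
        proof -
          have "\<bar>Re z - \<sigma>\<bar> \<le> \<bar>b - a\<bar>" using z(1) \<sigma> by auto
          then show ?thesis by (simp add: E_def abs_le_square_iff)
        qed
        have vert: "norm (f z) * (t powr (\<kappa> * Re z) * exp ((Re z - \<sigma>)\<^sup>2 - (Im z - t)\<^sup>2)) \<le> C' * t powr \<delta>"
          if "norm (f z) \<le> C * Im z powr e" "E * (C * 2 powr \<bar>e\<bar>) \<le> C'" "e = \<delta> - \<kappa> * Re z" for e
        proof -
          have "norm (f z) \<le> C * (2 powr \<bar>e\<bar> * t powr e)"
            using z t by (intro order.trans[OF that(1)] mult_left_mono powr_comparable C) auto
          moreover have "exp ((Re z - \<sigma>)\<^sup>2 - (Im z - t)\<^sup>2) \<le> E"
            by (rule order.trans[OF _ sq]) simp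
          ultimately have "norm (f z) * (t powr (\<kappa> * Re z) * exp ((Re z - \<sigma>)\<^sup>2 - (Im z - t)\<^sup>2))
             \<le> (C * (2 powr \<bar>e\<bar> * t powr e)) * (t powr (\<kappa> * Re z) * E)"
            using C by (intro mult_mono) auto
          also have "\<dots> = E * (C * 2 powr \<bar>e\<bar>) * (t powr (e + \<kappa> * Re z))"
            by (simp add: powr_add)
          also have "\<dots> \<le> C' * t powr \<delta>"
            using that by (intro mult_mono) (auto simp: C'_def E_def C)
          finally show ?thesis .
        qed
        have zeq: "z = Complex (Re z) (Im z)" by simp
        consider "Re z = a" | "Re z = b" | "\<bar>Im z - t\<bar> = t / 2" using z(3) by blast
        then show "norm (G z) \<le> C' * t powr \<delta>"
          unfolding nG
        proof cases
          case 1
          show "norm (f z) * (t powr (\<kappa> * Re z) * exp ((Re z - \<sigma>)\<^sup>2 - (Im z - t)\<^sup>2)) \<le> C' * t powr \<delta>"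
            using left[of "Im z"] z 1 elim parts zeq by (intro vert[of e1]) (auto simp: e1_def)
        next
          case 2
          show "norm (f z) * (t powr (\<kappa> * Re z) * exp ((Re z - \<sigma>)\<^sup>2 - (Im z - t)\<^sup>2)) \<le> C' * t powr \<delta>"
            using right[of "Im z"] z 2 elim parts zeq by (intro vert[of e2]) (auto simp: e2_def)
        next
          case 3
          have "(Im z - t)\<^sup>2 = (t / 2)\<^sup>2" using 3 by (metis power2_abs)
          then have ex: "exp ((Re z - \<sigma>)\<^sup>2 - (Im z - t)\<^sup>2) = exp ((Re z - \<sigma>)\<^sup>2) * exp (-(t\<^sup>2/4))"
            by (simp add: power_divide flip: exp_add)
          have "norm z \<le> 2 * t + c"
            using cmod_le[of z] z t by (auto simp: c_def)
          then have "norm (f z) \<le> \<bar>M\<bar> * (2 * t + c) ^ k"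
            using z elim by (intro order.trans[OF growth] mult_mono power_mono) auto
          moreover have "t powr (\<kappa> * Re z) \<le> t powr d"
          proof (rule powr_mono)
            have "\<kappa> * Re z \<le> \<bar>\<kappa>\<bar> * \<bar>Re z\<bar>" by (metis abs_mult abs_ge_self)
            also have "\<dots> \<le> d" unfolding d_def using z by (intro mult_left_mono) (auto simp: c_def)
            finally show "\<kappa> * Re z \<le> d" .
          qed (use elim in auto)
          ultimately have "norm (f z) * (t powr (\<kappa> * Re z) * exp ((Re z - \<sigma>)\<^sup>2 - (Im z - t)\<^sup>2))
             \<le> (\<bar>M\<bar> * (2 * t + c) ^ k) * (t powr d * (E * exp (-(t\<^sup>2/4))))"
            unfolding ex using sq t by (intro mult_mono) (auto simp: c_def E_def)
          also have "\<dots> = E * t powr \<delta> * (\<bar>M\<bar> * (2 * t + c) ^ k * (t powr (d - \<delta>) * exp (-(t\<^sup>2 / 4))))"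
            using t by (simp add: powr_diff)
          also have "\<dots> \<le> E * t powr \<delta> * 1"
            using elim(1) by (intro mult_left_mono) (auto simp: E_def)
          also have "\<dots> \<le> C' * t powr \<delta>" using parts by (simp add: mult_right_mono)
          finally show "norm (f z) * (t powr (\<kappa> * Re z) * exp ((Re z - \<sigma>)\<^sup>2 - (Im z - t)\<^sup>2)) \<le> C' * t powr \<delta>" .
        qed
      qed
      then have "norm (f (Complex \<sigma> t)) * t powr (\<kappa> * \<sigma>) \<le> (C' * t powr (\<delta> - \<kappa> * \<sigma>)) * t powr (\<kappa> * \<sigma>)"
        using t by (simp add: nG powr_diff)
      then show "norm (f (Complex \<sigma> t)) \<le> C' * t powr (\<delta> - \<kappa> * \<sigma>)"
        using t by simp
    qed
  qed
  then show ?thesis by blast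
qed

text \<open>To the left of the critical line the slope 3/2 is chosen to match the decay x^(-3v/2) of
  the integrand at height v; it is obtained by weakening the exponent 4 at abscissa -5/2 to \<delta>
  + 9/2. The weakened bound would leave no decay on that line, which is why the exponent 4 is kept
  as a separate bound.\<close>

lemma lindelof_strip:
  assumes "lindelof_hypothesis" and \<delta>: "\<delta> > 0"
  obtains C where "C \<ge> 0"
    "\<forall>\<^sub>F t in at_top. \<forall>u\<in>{0..3}. norm (zeta (Complex (1/2 + u) t)) \<le> C * t powr \<delta>"
    "\<forall>\<^sub>F t in at_top. \<forall>u\<in>{0..3}. norm (zeta (Complex (1/2 - u) t)) \<le> C * t powr (\<delta> + 3/2 * u)"
    "\<forall>\<^sub>F t in at_top. norm (zeta (Complex (-5/2) t)) \<le> C * t powr 4"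
proof -
  have "(\<lambda>t::real. zeta (1 / 2 + \<i> * of_real t)) \<in> O[at_top](\<lambda>t. of_real (t powr \<delta>))"
    using assms by (simp add: lindelof_hypothesis_def)
  then obtain c where "\<forall>\<^sub>F t::real in at_top. norm (zeta (1 / 2 + \<i> * of_real t)) \<le> c * norm (of_real (t powr \<delta>) :: complex)"
    by (elim landau_o.bigE)
  then obtain t1 where t1: "\<And>t. t \<ge> t1 \<Longrightarrow> norm (zeta (1 / 2 + \<i> * of_real t)) \<le> c * t powr \<delta>"
    unfolding eventually_at_top_linorder by auto
  \<comment> \<open>The exponent 4 belongs to 3/2 - 4 = -5/2 = 1/2 - 3, the abscissa of the
    horizontal side at height 3.\<close>
  obtain M where M: "M \<ge> 0" "\<And>s. Re s \<ge> 3/2 - real 4 \<Longrightarrow> Im s \<ge> 1 \<Longrightarrow> norm (zeta s) \<le> M * norm s ^ 4"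
    using zeta_polynomial_growth[of 4] by blast
  define K where "K = (\<Sum>n. real (Suc n) powr (- (3/2)))"
  have K: "K \<ge> 0" unfolding K_def by (intro suminf_nonneg summable_Suc_powr) auto
  define C where "C = \<bar>c\<bar> + K + M * 4 ^ 4"
  have C: "C \<ge> 0" using M K by (simp add: C_def)
  have crit: "norm (zeta (Complex (1/2) t)) \<le> C * t powr \<delta>" if "t \<ge> t1" for t
  proof -
    have "Complex (1/2) t = 1/2 + \<i> * of_real t" by (simp add: complex_eq_iff)
    then have "norm (zeta (Complex (1/2) t)) \<le> c * t powr \<delta>" using t1[OF that] by simp
    also have "\<dots> \<le> C * t powr \<delta>" using M K by (intro mult_right_mono) (auto simp: C_def)
    finally show ?thesis .
  qed
  have hol: "zeta holomorphic_on {s. Im s > 0}"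
    by (rule holomorphic_on_subset[OF zeta_holomorphic]) auto
  have "\<exists>C'. \<forall>\<^sub>F t in at_top. \<forall>\<sigma>\<in>{1/2..7/2}. norm (zeta (Complex \<sigma> t)) \<le> C' * t powr (\<delta> - 0 * \<sigma>)"
  proof (rule strip_interpolation[OF hol _ C, where M = M and k = 4 and T = "max 1 t1"])
    show "norm (zeta (Complex (7/2) t)) \<le> C * t powr (\<delta> - 0 * (7/2))" if "t \<ge> max 1 t1" for t
    proof -
      have "norm (zeta (Complex (7/2) t)) \<le> K * 1"
        unfolding K_def using zeta_bounded_right[of "3/2" "Complex (7/2) t"] by simp
      also have "\<dots> \<le> C * t powr \<delta>"
        using M K that \<delta> by (intro mult_mono ge_one_powr_ge_zero) (auto simp: C_def)
      finally show ?thesis by simp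
    qed
  qed (use crit M in auto)
  then obtain C1 where C1: "\<forall>\<^sub>F t in at_top. \<forall>\<sigma>\<in>{1/2..7/2}. norm (zeta (Complex \<sigma> t)) \<le> C1 * t powr \<delta>"
    by auto
  have far: "norm (zeta (Complex (-5/2) t)) \<le> C * t powr 4" if t: "t \<ge> 1" for t
  proof -
    have "norm (Complex (-5/2) t) \<le> 4 * t" using cmod_le[of "Complex (-5/2) t"] t by simp
    then have "norm (zeta (Complex (-5/2) t)) \<le> M * (4 * t) ^ 4"
      using t M by (intro order.trans[OF M(2)] mult_left_mono power_mono) auto
    also have "\<dots> = M * 4 ^ 4 * t powr 4"
      using t by (simp add: power_mult_distrib)
    also have "\<dots> \<le> C * t powr 4"
      using K by (intro mult_right_mono) (auto simp: C_def)
    finally show ?thesis .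
  qed
  have "\<exists>C'. \<forall>\<^sub>F t in at_top. \<forall>\<sigma>\<in>{-5/2..1/2}. norm (zeta (Complex \<sigma> t)) \<le> C' * t powr ((\<delta> + 3/4) - 3/2 * \<sigma>)"
  proof (rule strip_interpolation[OF hol _ C, where M = M and k = 4 and T = "max 1 t1"])
    show "norm (zeta (Complex (-5/2) t)) \<le> C * t powr ((\<delta> + 3/4) - 3/2 * (-5/2))" if "t \<ge> max 1 t1" for t
    proof -
      have "norm (zeta (Complex (-5/2) t)) \<le> C * t powr 4" using that by (intro far) simp
      also have "\<dots> \<le> C * t powr ((\<delta> + 3/4) - 3/2 * (-5/2))"
        using C that \<delta> by (intro mult_left_mono powr_mono) auto
      finally show ?thesis .
    qed
  qed (use crit M in auto)
  then obtain C2 where C2: "\<forall>\<^sub>F t in at_top. \<forall>\<sigma>\<in>{-5/2..1/2}. norm (zeta (Complex \<sigma> t)) \<le> C2 * t powr ((\<delta> + 3/4) - 3/2 * \<sigma>)"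
    by auto
  define C' where "C' = max C (max C1 C2)"
  show ?thesis
  proof (rule that[of C'])
    show "C' \<ge> 0" using C by (simp add: C'_def)
    show "\<forall>\<^sub>F t in at_top. norm (zeta (Complex (-5/2) t)) \<le> C' * t powr 4"
      using eventually_ge_at_top[of 1]
    proof eventually_elim
      case (elim t)
      have "C * t powr 4 \<le> C' * t powr 4" by (intro mult_right_mono) (auto simp: C'_def)
      then show ?case using far[OF elim] by linarith
    qed
    show "\<forall>\<^sub>F t in at_top. \<forall>u\<in>{0..3}. norm (zeta (Complex (1/2 + u) t)) \<le> C' * t powr \<delta>"
      using C1
    proof eventually_elim
      case (elim t)
      have "norm (zeta (Complex (1/2 + u) t)) \<le> C1 * t powr \<delta>" if "u \<in> {0..3}" for u
        using elim that by auto
      moreover have "C1 * t powr \<delta> \<le> C' * t powr \<delta>" by (intro mult_right_mono) (auto simp: C'_def)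
      ultimately show ?case by (meson order.trans)
    qed
    show "\<forall>\<^sub>F t in at_top. \<forall>u\<in>{0..3}. norm (zeta (Complex (1/2 - u) t)) \<le> C' * t powr (\<delta> + 3/2 * u)"
      using C2
    proof eventually_elim
      case (elim t)
      show ?case
      proof
        fix u :: real assume u: "u \<in> {0..3}"
        have "norm (zeta (Complex (1/2 - u) t)) \<le> C2 * t powr ((\<delta> + 3/4) - 3/2 * (1/2 - u))"
          by (rule bspec[OF elim]) (use u in auto)
        also have "(\<delta> + 3/4) - 3/2 * (1/2 - u) = \<delta> + 3/2 * u" by (simp add: field_simps)
        also have "C2 * t powr (\<delta> + 3/2 * u) \<le> C' * t powr (\<delta> + 3/2 * u)"
          by (intro mult_right_mono) (auto simp: C'_def)
        finally show "norm (zeta (Complex (1/2 - u) t)) \<le> C' * t powr (\<delta> + 3/2 * u)" .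
      qed
    qed
  qed
qed

section \<open>The digamma function far from the real axis\<close>

text \<open>Taylor expansion of Ln with second-order remainder along a unit step; |Im z| \<ge> 5
  keeps the segment off the cut even where Re z is negative. With q = n + |Im z| - 3, the estimate
  |Re w| + |Im w| \<ge> q gives |w|^2 \<ge> q^2/2, and 2/q^2 \<le> 2/(q-1) - 2/q makes the bounds
  telescope.\<close>

lemma Ln_step_bound:
  fixes z :: complex
  assumes z: "\<bar>Re z\<bar> \<le> 3" "\<bar>Im z\<bar> \<ge> 5"
  shows "norm (Ln (z + of_nat (Suc n)) - Ln (z + of_nat n) - inverse (z + of_nat n))
           \<le> 2 / (real n + \<bar>Im z\<bar> - 4) - 2 / (real (Suc n) + \<bar>Im z\<bar> - 4)"
proof -
  define S where "S = closed_segment (z + of_nat n) (z + of_nat (Suc n))"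
  define f where "f = (\<lambda>(i::nat) w. if i = 0 then Ln w else if i = 1 then inverse w else - inverse (w\<^sup>2) :: complex)"
  define q where "q = real n + \<bar>Im z\<bar> - 3"
  have q: "q \<ge> 2" using z by (simp add: q_def)
  have S: "Im w = Im z" "Re w \<ge> real n - 3" if "w \<in> S" for w
  proof -
    have "\<exists>u. 0 \<le> u \<and> u \<le> 1 \<and> w = (1 - u) *\<^sub>R (z + of_nat n) + u *\<^sub>R (z + of_nat (Suc n))"
      using that unfolding S_def in_segment(1) .
    then obtain u where u: "0 \<le> u" "w = (1 - u) *\<^sub>R (z + of_nat n) + u *\<^sub>R (z + of_nat (Suc n))"
      by (elim exE conjE)
    then have "w = z + of_nat n + of_real u" by (simp add: scaleR_conv_of_real algebra_simps)
    with u(1) show "Im w = Im z" "Re w \<ge> real n - 3" using z by auto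
  qed
  have bd: "norm (inverse (w\<^sup>2)) \<le> 2 / q\<^sup>2" if "w \<in> S" for w
  proof -
    have "q \<le> \<bar>Re w\<bar> + \<bar>Im w\<bar>" using S[OF that] by (auto simp: q_def)
    then have "q\<^sup>2 \<le> (\<bar>Re w\<bar> + \<bar>Im w\<bar>)\<^sup>2" using q by (intro power_mono) auto
    also have "\<dots> \<le> 2 * (norm w)\<^sup>2"
      using sum_squares_bound[of "\<bar>Re w\<bar>" "\<bar>Im w\<bar>"] by (simp add: cmod_power2 power2_sum)
    finally have "q\<^sup>2 / 2 \<le> (norm w)\<^sup>2" by simp
    then have "inverse ((norm w)\<^sup>2) \<le> inverse (q\<^sup>2 / 2)" using q by (intro le_imp_inverse_le) auto
    then show ?thesis by (simp add: norm_inverse norm_power)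
  qed
  have "norm (f 0 (z + of_nat (Suc n)) - (\<Sum>i\<le>1. f i (z + of_nat n) * ((z + of_nat (Suc n)) - (z + of_nat n)) ^ i / fact i))
          \<le> 2 / q\<^sup>2 * norm ((z + of_nat (Suc n)) - (z + of_nat n)) ^ Suc 1 / fact 1"
  proof (rule complex_Taylor[of S])
    fix i :: nat and w assume w: "w \<in> S" and i: "i \<le> 1"
    have "w \<notin> \<real>\<^sub>\<le>\<^sub>0" "w \<noteq> 0" using S(1)[OF w] z by (auto simp: complex_nonpos_Reals_iff complex_eq_iff)
    then show "(f i has_field_derivative f (Suc i) w) (at w within S)"
      using i by (cases i) (auto simp: f_def power2_eq_square intro!: derivative_eq_intros)
  next
    show "norm (f (Suc 1) w) \<le> 2 / q\<^sup>2" if "w \<in> S" for w using bd[OF that] by (simp add: f_def)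
  qed (auto simp: S_def)
  then have "norm (Ln (z + of_nat (Suc n)) - Ln (z + of_nat n) - inverse (z + of_nat n)) \<le> 2 / q\<^sup>2"
    by (simp add: f_def algebra_simps)
  also have "\<dots> \<le> 2 / ((q - 1) * q)"
    using q by (intro divide_left_mono) (auto simp: power2_eq_square)
  also have "\<dots> = 2 / (q - 1) - 2 / q" using q by (simp add: field_simps)
  also have "\<dots> = 2 / (real n + \<bar>Im z\<bar> - 4) - 2 / (real (Suc n) + \<bar>Im z\<bar> - 4)"
    by (simp add: q_def)
  finally show ?thesis .
qed

text \<open>\<open>Digamma\<close> is the limit of ln m minus the sum of 1/(z+n). Adding the
  vanishing term Ln (1 + z/m) turns ln m into Ln (z+m), and the difference from Ln z becomes a sum
  of the steps of \<open>Ln_step_bound\<close>. The range |Re z| \<le> 3 covers both points 1/4 +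
  \<i> t/2 and 1/4 - \<i> t/2 for |Im t| \<le> 4.\<close>

lemma Digamma_Ln_bound:
  fixes z :: complex
  assumes z: "\<bar>Re z\<bar> \<le> 3" "\<bar>Im z\<bar> \<ge> 5"
  shows "norm (Digamma z - Ln z) \<le> 2 / (\<bar>Im z\<bar> - 4)"
proof (rule tendsto_upperbound)
  have z0: "z \<noteq> 0" using z by auto
  have "(\<lambda>m. Ln (1 + z / of_nat m)) \<longlonglongrightarrow> Ln (1 + 0)"
    by (intro tendsto_intros tendsto_divide_0[OF tendsto_const] tendsto_of_nat) auto
  then have "(\<lambda>m. of_real (ln (real m)) - (\<Sum>n<m. inverse (z + of_nat n)) - Ln z + Ln (1 + z / of_nat m))
      \<longlonglongrightarrow> Digamma z - Ln z + 0"
    by (intro tendsto_intros Digamma_LIMSEQ z0) simp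
  then show "(\<lambda>m. norm (of_real (ln (real m)) - (\<Sum>n<m. inverse (z + of_nat n)) - Ln z + Ln (1 + z / of_nat m)))
      \<longlonglongrightarrow> norm (Digamma z - Ln z)"
    by (intro tendsto_norm) simp
  show "\<forall>\<^sub>F m in sequentially. norm (of_real (ln (real m)) - (\<Sum>n<m. inverse (z + of_nat n)) - Ln z + Ln (1 + z / of_nat m))
      \<le> 2 / (\<bar>Im z\<bar> - 4)"
    using eventually_gt_at_top[of 0]
  proof eventually_elim
    case (elim m)
    have "Im (z + of_nat m) \<noteq> 0" using z by auto
    then have "z + of_nat m \<noteq> 0" by (metis zero_complex.sel(2))
    then have "1 + z / of_nat m \<noteq> 0" using elim by (auto simp: field_simps)
    then have "Ln (of_real (real m) * (1 + z / of_nat m)) = of_real (ln (real m)) + Ln (1 + z / of_nat m)"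
      using elim by (subst Ln_times_of_real) auto
    also have "of_real (real m) * (1 + z / of_nat m) = z + of_nat m" using elim by (simp add: field_simps)
    finally have Lm: "Ln (z + of_nat m) = of_real (ln (real m)) + Ln (1 + z / of_nat m)" .
    have "of_real (ln (real m)) - (\<Sum>n<m. inverse (z + of_nat n)) - Ln z + Ln (1 + z / of_nat m) =
      (\<Sum>n<m. Ln (z + of_nat (Suc n)) - Ln (z + of_nat n) - inverse (z + of_nat n))"
    proof -
      have "(\<Sum>n<m. Ln (z + of_nat (Suc n)) - Ln (z + of_nat n)) = Ln (z + of_nat m) - Ln (z + of_nat 0)"
        by (rule sum_lessThan_telescope)
      then show ?thesis
        unfolding Lm sum_subtractf[of _ "\<lambda>n. inverse (z + of_nat n)"] by simp
    qed
    also have "norm \<dots> \<le> (\<Sum>n<m. 2 / (real n + \<bar>Im z\<bar> - 4) - 2 / (real (Suc n) + \<bar>Im z\<bar> - 4))"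
      by (intro sum_norm_le Ln_step_bound z)
    also have "\<dots> = 2 / (\<bar>Im z\<bar> - 4) - 2 / (real m + \<bar>Im z\<bar> - 4)"
      by (subst sum_lessThan_telescope') simp
    also have "\<dots> \<le> 2 / (\<bar>Im z\<bar> - 4)" using z by simp
    finally show ?case .
  qed
qed simp

section \<open>The theta function in a strip\<close>

text \<open>The holomorphic extension of \<open>RS_theta\<close>: for real t the two values of
  \<open>ln_Gamma\<close> are conjugate, so the quotient is an imaginary part. For Re t > 0 neither
  argument meets the cut.\<close>

definition Theta :: "complex \<Rightarrow> complex" where
  "Theta t = - t / 2 * of_real (ln pi) +
     (ln_Gamma (1/4 + \<i> * (t / 2)) - ln_Gamma (1/4 - \<i> * (t / 2))) / (2 * \<i>)"

definition Theta' :: "complex \<Rightarrow> complex" where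
  "Theta' t = - of_real (ln pi) / 2 +
     (Digamma (1/4 + \<i> * (t / 2)) + Digamma (1/4 - \<i> * (t / 2))) / 4"

lemma has_field_derivative_Theta:
  assumes "Re t > 0"
  shows "(Theta has_field_derivative Theta' t) (at t)"
proof -
  have "1/4 + \<i> * (t / 2) \<notin> \<real>\<^sub>\<le>\<^sub>0" "1/4 - \<i> * (t / 2) \<notin> \<real>\<^sub>\<le>\<^sub>0"
    using assms by (auto simp: complex_nonpos_Reals_iff)
  then show ?thesis
    unfolding Theta_def Theta'_def
    by (auto intro!: derivative_eq_intros simp: field_simps)
qed

text \<open>The approximants contain only principal logarithms of points in the right half-plane,
  and these commute with conjugation.\<close>

lemma cnj_ln_Gamma:
  assumes "Re z > 0"
  shows "ln_Gamma (cnj z) = cnj (ln_Gamma z)"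
proof (rule LIMSEQ_unique)
  have nz: "w \<notin> \<int>\<^sub>\<le>\<^sub>0" if "Re w > 0" for w :: complex
    using that by (auto elim!: nonpos_Ints_cases)
  show "ln_Gamma_series (cnj z) \<longlonglongrightarrow> ln_Gamma (cnj z)"
    by (rule ln_Gamma_complex_LIMSEQ, rule nz) (use assms in simp)
  have Ln: "ln (cnj w) = cnj (ln w)" if "Re w > 0" for w
    using that by (intro cnj_Ln[symmetric]) (auto simp: complex_nonpos_Reals_iff)
  have conj: "ln_Gamma_series (cnj z) n = cnj (ln_Gamma_series z n)" if n: "n > 0" for n
  proof -
    have "ln (cnj z / of_nat k + 1) = cnj (ln (z / of_nat k + 1))" for k
    proof -
      have "Re (z / of_nat k + 1) > 0"
        using assms by (simp add: add_nonneg_pos)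
      from Ln[OF this] show ?thesis by simp
    qed
    moreover have "ln (of_nat n) = cnj (ln (of_nat n :: complex))"
      using n by (simp add: Ln_of_nat)
    ultimately show ?thesis
      using Ln[OF assms] by (simp add: ln_Gamma_series_def)
  qed
  have "\<forall>\<^sub>F n in sequentially. cnj (ln_Gamma_series z n) = ln_Gamma_series (cnj z) n"
    using eventually_gt_at_top[of 0] by (rule eventually_mono) (simp add: conj)
  moreover have "(\<lambda>n. cnj (ln_Gamma_series z n)) \<longlonglongrightarrow> cnj (ln_Gamma z)"
    unfolding lim_cnj by (intro ln_Gamma_complex_LIMSEQ nz assms)
  ultimately show "ln_Gamma_series (cnj z) \<longlonglongrightarrow> cnj (ln_Gamma z)"
    by (rule Lim_transform_eventually[rotated])
qed

lemma Theta_of_real: "Theta (of_real x) = of_real (RS_theta x)"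
proof -
  have "1/4 - \<i> * (of_real x / 2) = cnj (1/4 + \<i> * (of_real x / 2))"
    by (simp add: complex_eq_iff)
  then have "ln_Gamma (1/4 - \<i> * (of_real x / 2)) = cnj (ln_Gamma (1/4 + \<i> * (of_real x / 2)))"
    using cnj_ln_Gamma[of "1/4 + \<i> * (of_real x / 2)"] by simp
  then show ?thesis
    unfolding Theta_def RS_theta_def by (simp add: complex_diff_cnj complex_eq_iff)
qed

text \<open>Stirling's formula to leading order with crude constants. The two arguments of
  \<open>Digamma\<close> are \<i> p and -\<i> q with p and q near t/2, and the shifts by \<i> pi/2
  and -\<i> pi/2 in their logarithms cancel. The threshold exp 8 makes ln x / 2 - 3 \<ge> 1, so Re
  Theta' \<ge> 1 throughout.\<close>

lemma Theta'_bounds: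
  assumes x: "Re t \<ge> exp 8" and y: "\<bar>Im t\<bar> \<le> 4"
  shows "Re (Theta' t) \<ge> ln (Re t) / 2 - 3"
    and "\<bar>Im (Theta' t)\<bar> \<le> 1/8"
    and "norm (Theta' t) \<le> ln (Re t) / 2 + 4"
proof -
  have e8: "exp 8 \<ge> (256 :: real)"
  proof -
    have "(2::real) ^ 8 \<le> exp 1 ^ 8" using exp_ge_add_one_self[of 1] by (intro power_mono) auto
    then show ?thesis by (simp flip: exp_of_nat_mult)
  qed
  have x1: "Re t \<ge> 256" using e8 x by linarith
  define z w where "z = 1/4 + \<i> * (t / 2)" and "w = 1/4 - \<i> * (t / 2)"
  define p q where "p = t / 2 - \<i> / 4" and "q = t / 2 + \<i> / 4"
  have D: "norm (Digamma v - Ln v) \<le> 1/40" if "\<bar>Re v\<bar> \<le> 3" "\<bar>Im v\<bar> = Re t / 2" for v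
  proof -
    have "norm (Digamma v - Ln v) \<le> 2 / (\<bar>Im v\<bar> - 4)" using that x1 by (intro Digamma_Ln_bound) auto
    also have "\<dots> \<le> 2 / 80" using that x1 by (intro divide_left_mono) auto
    finally show ?thesis by simp
  qed
  have Dz: "norm (Digamma z - Ln z) \<le> 1/40" using y x1 by (intro D) (auto simp: z_def)
  have Dw: "norm (Digamma w - Ln w) \<le> 1/40" using y x1 by (intro D) (auto simp: w_def)
  have "z = \<i> * p" "w = - \<i> * q" by (auto simp: z_def w_def p_def q_def field_simps)
  moreover have "p \<noteq> 0" "q \<noteq> 0" "Re p > 0" "Re q > 0" using x1 by (auto simp: p_def q_def complex_eq_iff)
  ultimately have "Ln z = Ln p + \<i> * of_real pi / 2" "Ln w = Ln q - \<i> * of_real pi / 2"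
    by (simp_all add: Ln_times_ii Ln_minus)
  then have "Ln p + Ln q = Ln z + Ln w" by simp
  then have eq: "Theta' t = - of_real (ln pi) / 2 + (Ln p + Ln q) / 4 + ((Digamma z - Ln z) + (Digamma w - Ln w)) / 4"
    unfolding Theta'_def z_def[symmetric] w_def[symmetric] by (simp only:) (simp add: field_simps)
  have Lre: "ln (Re t / 2) \<le> Re (Ln v)" "Re (Ln v) \<le> ln (Re t)" "\<bar>Im (Ln v)\<bar> \<le> 1/20"
    if v: "Re v = Re t / 2" "\<bar>Im v\<bar> \<le> 3" for v
  proof -
    have v0: "v \<noteq> 0" using v x1 by auto
    show "ln (Re t / 2) \<le> Re (Ln v)"
      using complex_Re_le_cmod[of v] v v0 x1 by simp
    have "norm v \<le> Re t" using cmod_le[of v] v x1 by simp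
    then show "Re (Ln v) \<le> ln (Re t)" using v0 x1 by simp
    have "Im (Ln v) = arctan (Im v / Re v)" using v x1 v0 by (simp add: Im_Ln_eq)
    also have "\<bar>\<dots>\<bar> \<le> \<bar>Im v / Re v\<bar>" by (rule abs_arctan_le)
    also have "\<dots> \<le> 3 / 64" using v x1 unfolding abs_divide by (intro frac_le) auto
    finally show "\<bar>Im (Ln v)\<bar> \<le> 1/20" by simp
  qed
  have P: "ln (Re t / 2) \<le> Re (Ln p)" "Re (Ln p) \<le> ln (Re t)" "\<bar>Im (Ln p)\<bar> \<le> 1/20"
    by (rule Lre; use y in \<open>simp add: p_def\<close>)+
  have Q: "ln (Re t / 2) \<le> Re (Ln q)" "Re (Ln q) \<le> ln (Re t)" "\<bar>Im (Ln q)\<bar> \<le> 1/20"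
    by (rule Lre; use y in \<open>simp add: q_def\<close>)+
  have lnpi: "ln pi \<le> 3" "ln pi \<ge> 0"
    using ln_le_minus_one[of pi] pi_less_4 pi_gt3 by auto
  have ln2: "ln (Re t / 2) \<ge> ln (Re t) - 1"
    using x1 ln_2_less_1 by (simp add: ln_div)
  have lnt: "ln (Re t) \<ge> 0" using x1 by simp
  have d: "\<bar>Re (Digamma z - Ln z)\<bar> \<le> 1/40" "\<bar>Im (Digamma z - Ln z)\<bar> \<le> 1/40"
    "\<bar>Re (Digamma w - Ln w)\<bar> \<le> 1/40" "\<bar>Im (Digamma w - Ln w)\<bar> \<le> 1/40"
    using Dz Dw abs_Re_le_cmod abs_Im_le_cmod by (blast intro: order.trans)+
  have Re: "Re (Theta' t) = - ln pi / 2 + (Re (Ln p) + Re (Ln q)) / 4 + (Re (Digamma z - Ln z) + Re (Digamma w - Ln w)) / 4"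
   and Im: "Im (Theta' t) = (Im (Ln p) + Im (Ln q)) / 4 + (Im (Digamma z - Ln z) + Im (Digamma w - Ln w)) / 4"
    unfolding eq by (simp_all del: Re_Ln)
  show 1: "Re (Theta' t) \<ge> ln (Re t) / 2 - 3" unfolding Re using P(1) Q(1) d(1,3)[unfolded abs_le_iff] lnpi ln2 by argo
  show 2: "\<bar>Im (Theta' t)\<bar> \<le> 1/8" unfolding Im using P(3) Q(3) d(2,4) unfolding abs_le_iff by argo
  have "Re (Theta' t) \<le> ln (Re t) / 2 + 1" unfolding Re using P(2) Q(2) d(1,3)[unfolded abs_le_iff] lnpi by argo
  then have "\<bar>Re (Theta' t)\<bar> \<le> ln (Re t) / 2 + 3" using 1 lnt by linarith
  then show "norm (Theta' t) \<le> ln (Re t) / 2 + 4" using 2 cmod_le[of "Theta' t"] by linarith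
qed

section \<open>Variation of theta along vertical and real segments\<close>

lemma mvt_symmetric:
  fixes g g' :: "real \<Rightarrow> real"
  assumes der: "\<And>v. \<bar>v\<bar> \<le> r \<Longrightarrow> (g has_real_derivative g' v) (at v)" and y: "\<bar>y\<bar> \<le> r"
  obtains v where "\<bar>v\<bar> \<le> r" "g y - g 0 = y * g' v"
proof (cases y "0::real" rule: linorder_cases)
  case less
  then obtain v where "y < v" "v < 0" "g 0 - g y = (0 - y) * g' v"
    using MVT2[of y 0 g g'] der y by auto
  then show ?thesis using that[of v] y by auto
next
  case equal
  then show ?thesis using that[of 0] y by auto
next
  case greater
  then obtain v where "0 < v" "v < y" "g y - g 0 = (y - 0) * g' v"
    using MVT2[of 0 y g g'] der y by auto
  then show ?thesis using that[of v] y by auto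
qed

text \<open>The derivative along a vertical line is \<i> * Theta', so the imaginary part grows at
  the rate Re Theta' and the real part moves only at the rate - Im Theta'. The product form y * c
  serves both signs of y.\<close>

lemma Theta_vertical:
  assumes x: "x \<ge> exp 8" and y: "\<bar>y\<bar> \<le> 4"
  shows "\<exists>c \<ge> ln x / 2 - 3. Im (Theta (Complex x y)) = y * c"
    and "\<bar>Re (Theta (Complex x y)) - RS_theta x\<bar> \<le> \<bar>y\<bar> / 8"
proof -
  have x0: "x > 0" using x less_le_trans[OF exp_gt_zero] by blast
  have vec: "((\<lambda>v. Theta (Complex x v)) has_vector_derivative \<i> * Theta' (Complex x v)) (at v)" for v
  proof -
    have "((\<lambda>v. Complex x v) has_vector_derivative \<i>) (at v)"
    proof -
      have "((\<lambda>v. of_real x + \<i> * of_real v) has_vector_derivative \<i>) (at v)"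
        by (auto intro!: derivative_eq_intros)
      then show ?thesis by (simp add: Complex_eq)
    qed
    from field_vector_diff_chain_at[OF this, of Theta] has_field_derivative_Theta[of "Complex x v"] x0
    show ?thesis by (simp add: o_def)
  qed
  have base: "Theta (Complex x 0) = of_real (RS_theta x)"
    using Theta_of_real[of x] by (simp add: complex_of_real_def)
  have "((\<lambda>v. Im (Theta (Complex x v))) has_real_derivative Re (Theta' (Complex x v))) (at v)" for v
    using bounded_linear.has_vector_derivative[OF bounded_linear_Im vec[of v]] by (simp add: has_real_derivative_iff_has_vector_derivative)
  from mvt_symmetric[OF this y] obtain v where
    v: "\<bar>v\<bar> \<le> 4" "Im (Theta (Complex x y)) - Im (Theta (Complex x 0)) = y * Re (Theta' (Complex x v))" by blast
  then show "\<exists>c \<ge> ln x / 2 - 3. Im (Theta (Complex x y)) = y * c"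
    using Theta'_bounds(1)[of "Complex x v"] x by (intro exI[of _ "Re (Theta' (Complex x v))"]) (auto simp: base)
  have "((\<lambda>v. Re (Theta (Complex x v))) has_real_derivative - Im (Theta' (Complex x v))) (at v)" for v
    using bounded_linear.has_vector_derivative[OF bounded_linear_Re vec[of v]] by (simp add: has_real_derivative_iff_has_vector_derivative)
  from mvt_symmetric[OF this y] obtain v where
    v: "\<bar>v\<bar> \<le> 4" "Re (Theta (Complex x y)) - Re (Theta (Complex x 0)) = y * - Im (Theta' (Complex x v))" by blast
  then have "\<bar>Re (Theta (Complex x y)) - RS_theta x\<bar> = \<bar>y\<bar> * \<bar>Im (Theta' (Complex x v))\<bar>"
    by (simp add: base abs_mult)
  also have "\<dots> \<le> \<bar>y\<bar> * (1/8)"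
    using Theta'_bounds(2)[of "Complex x v"] x v by (intro mult_left_mono) auto
  finally show "\<bar>Re (Theta (Complex x y)) - RS_theta x\<bar> \<le> \<bar>y\<bar> / 8" by simp
qed

text \<open>The derivative is at least 1 beyond exp 8. This turns phase differences into bounds for
  distances.\<close>

lemma RS_theta_expanding:
  assumes "exp 8 \<le> x" "x \<le> y"
  shows "RS_theta y - RS_theta x \<ge> y - x"
proof (cases "x = y")
  case False
  then have "x < y" using assms by simp
  moreover have "(RS_theta has_real_derivative Re (Theta' (of_real v))) (at v)" if "x \<le> v" for v
  proof -
    have "v > 0" using assms that less_le_trans[OF exp_gt_zero] by (meson order.trans)
    then have "((\<lambda>v. Theta (of_real v)) has_vector_derivative Theta' (of_real v)) (at v)"
      using has_vector_derivative_real_field[OF has_field_derivative_Theta[of "of_real v"]] by (simp add: o_def)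
    from bounded_linear.has_vector_derivative[OF bounded_linear_Re this]
    show ?thesis by (simp add: Theta_of_real has_real_derivative_iff_has_vector_derivative)
  qed
  ultimately obtain v where v: "x < v" "v < y" "RS_theta y - RS_theta x = (y - x) * Re (Theta' (of_real v))"
    using MVT2[of x y RS_theta "\<lambda>v. Re (Theta' (of_real v))"] by auto
  have "exp 8 \<le> v" using v assms by simp
  then have "8 \<le> ln v" using ln_ge_iff less_le_trans[OF exp_gt_zero] by blast
  moreover have "ln v / 2 - 3 \<le> Re (Theta' (of_real v))"
    using Theta'_bounds(1)[of "of_real v"] \<open>exp 8 \<le> v\<close> by simp
  ultimately have "1 \<le> Re (Theta' (of_real v))" by simp
  then show ?thesis using v mult_left_mono[of 1 "Re (Theta' (of_real v))" "y - x"] by simp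
qed simp

section \<open>Contours\<close>

text \<open>Half of a rectangle boundary, cut at the real axis. Both halves share their real end
  points, so the integral of a function with a primitive depends on a and b only.\<close>

definition detour :: "real \<Rightarrow> real \<Rightarrow> real \<Rightarrow> real \<Rightarrow> complex" where
  "detour a b h = linepath (of_real a) (Complex a h) +++
     linepath (Complex a h) (Complex b h) +++ linepath (Complex b h) (of_real b)"

lemma valid_path_detour [simp]: "valid_path (detour a b h)"
  by (simp add: detour_def)

lemma pathstart_detour [simp]: "pathstart (detour a b h) = of_real a"
  and pathfinish_detour [simp]: "pathfinish (detour a b h) = of_real b"
  by (simp_all add: detour_def)

lemma path_image_detour:
  "path_image (detour a b h) = closed_segment (of_real a) (Complex a h) \<union>
     closed_segment (Complex a h) (Complex b h) \<union> closed_segment (Complex b h) (of_real b)"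
  by (simp add: detour_def path_image_join Un_assoc)

lemma contour_integral_detour:
  assumes "continuous_on (path_image (detour a b h)) f"
  shows "contour_integral (detour a b h) f = contour_integral (linepath (of_real a) (Complex a h)) f +
     contour_integral (linepath (Complex a h) (Complex b h)) f +
     contour_integral (linepath (Complex b h) (of_real b)) f"
proof -
  have "f contour_integrable_on linepath (of_real a) (Complex a h)"
    "f contour_integrable_on linepath (Complex a h) (Complex b h)"
    "f contour_integrable_on linepath (Complex b h) (of_real b)"
    by (rule contour_integrable_continuous_linepath, rule continuous_on_subset[OF assms],
        force simp: path_image_detour)+
  then show ?thesis by (simp add: detour_def)
qed

text \<open>The rectangle runs counterclockwise: its lower half from left to right, its upper half
  from right to left, hence the minus sign. The vertical sides are split at the real axis.\<close>

lemma contour_integral_rectpath_detour: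
  assumes h: "h \<ge> 0" and ab: "a \<le> b"
    and f: "continuous_on (path_image (rectpath (Complex a (-h)) (Complex b h))) f"
  shows "contour_integral (rectpath (Complex a (-h)) (Complex b h)) f =
           contour_integral (detour a b (-h)) f - contour_integral (detour a b h) f"
proof -
  let ?a = "Complex a" and ?b = "Complex b"
  define R where "R = path_image (rectpath (?a (-h)) (?b h))"
  have R: "R = closed_segment (?a (-h)) (?b (-h)) \<union> closed_segment (?b (-h)) (?b h) \<union>
              closed_segment (?b h) (?a h) \<union> closed_segment (?a h) (?a (-h))"
    by (simp add: R_def rectpath_def Let_def path_image_join Un_assoc)
  have mid: "of_real a \<in> closed_segment (?a h) (?a (-h))" "of_real b \<in> closed_segment (?b (-h)) (?b h)"
    using h by (auto simp: closed_segment_same_Re closed_segment_eq_real_ivl)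
  then have "closed_segment (of_real a) (?a h) \<subseteq> closed_segment (?a h) (?a (-h))"
    "closed_segment (of_real a) (?a (-h)) \<subseteq> closed_segment (?a h) (?a (-h))"
    "closed_segment (of_real b) (?b h) \<subseteq> closed_segment (?b (-h)) (?b h)"
    "closed_segment (of_real b) (?b (-h)) \<subseteq> closed_segment (?b (-h)) (?b h)"
    by (simp_all add: subset_closed_segment)
  then have sub: "closed_segment (of_real a) (?a h) \<subseteq> R" "closed_segment (of_real a) (?a (-h)) \<subseteq> R"
    "closed_segment (of_real b) (?b h) \<subseteq> R" "closed_segment (of_real b) (?b (-h)) \<subseteq> R"
    unfolding R by blast+
  have cont: "continuous_on S f" if "S \<subseteq> R" for S
    using f that unfolding R_def by (rule continuous_on_subset)
  have int: "f contour_integrable_on linepath x y" if "closed_segment x y \<subseteq> R" for x y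
    using that by (intro contour_integrable_continuous_linepath cont)
  have rev: "contour_integral (linepath y x) f = - contour_integral (linepath x y) f" if "closed_segment x y \<subseteq> R" for x y
    using that by (subst contour_integral_reverse_linepath) (auto intro!: cont simp: closed_segment_commute)
  have det: "path_image (detour a b h) \<subseteq> R" "path_image (detour a b (-h)) \<subseteq> R"
    unfolding path_image_detour using sub unfolding R
    by (auto simp: closed_segment_commute)
  have "contour_integral (rectpath (?a (-h)) (?b h)) f =
     contour_integral (linepath (?a (-h)) (?b (-h))) f + (contour_integral (linepath (?b (-h)) (?b h)) f +
     (contour_integral (linepath (?b h) (?a h)) f + contour_integral (linepath (?a h) (?a (-h))) f))"
  proof -
    have "f contour_integrable_on linepath (?a (-h)) (?b (-h))" "f contour_integrable_on linepath (?b (-h)) (?b h)"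
      "f contour_integrable_on linepath (?b h) (?a h)" "f contour_integrable_on linepath (?a h) (?a (-h))"
      using R by (intro int; blast)+
    then show ?thesis by (simp add: rectpath_def Let_def)
  qed
  also have "contour_integral (linepath (?b (-h)) (?b h)) f =
      contour_integral (linepath (?b (-h)) (of_real b)) f + contour_integral (linepath (of_real b) (?b h)) f"
    using mid R by (intro contour_integral_split_linepath cont) auto
  also have "contour_integral (linepath (?a h) (?a (-h))) f =
      contour_integral (linepath (?a h) (of_real a)) f + contour_integral (linepath (of_real a) (?a (-h))) f"
    using mid R by (intro contour_integral_split_linepath cont) auto
  also have "contour_integral (linepath (?b h) (?a h)) f = - contour_integral (linepath (?a h) (?b h)) f"
    using R by (intro rev) (auto simp: closed_segment_commute)
  also have "contour_integral (linepath (?a h) (of_real a)) f = - contour_integral (linepath (of_real a) (?a h)) f"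
    using sub by (intro rev)
  also have "contour_integral (linepath (of_real b) (?b h)) f = - contour_integral (linepath (?b h) (of_real b)) f"
    using sub by (intro rev) (simp add: closed_segment_commute)
  finally show ?thesis
    unfolding contour_integral_detour[OF cont[OF det(1)]] contour_integral_detour[OF cont[OF det(2)]]
    by simp
qed

lemma contour_integral_detour_bound:
  assumes ab: "a \<le> b" and f: "continuous_on (path_image (detour a b h)) f"
    and V: "\<And>x v. x \<in> {a, b} \<Longrightarrow> v \<in> closed_segment 0 h \<Longrightarrow> norm (f (Complex x v)) \<le> V"
    and U: "\<And>x. x \<in> {a..b} \<Longrightarrow> norm (f (Complex x h)) \<le> U"
  shows "norm (contour_integral (detour a b h) f) \<le> 2 * \<bar>h\<bar> * V + (b - a) * U"
proof -
  have V0: "V \<ge> 0" and U0: "U \<ge> 0"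
    using order.trans[OF norm_ge_zero V[of a 0]] order.trans[OF norm_ge_zero U[of a]] ab by auto
  have seg: "f contour_integrable_on linepath (of_real a) (Complex a h)"
    "f contour_integrable_on linepath (Complex a h) (Complex b h)"
    "f contour_integrable_on linepath (Complex b h) (of_real b)"
    by (rule contour_integrable_continuous_linepath, rule continuous_on_subset[OF f],
        force simp: path_image_detour)+
  have V': "norm (f z) \<le> V" if "z \<in> closed_segment (of_real x) (Complex x h)" "x \<in> {a, b}" for z x
    using V[of x "Im z"] that
    by (cases z) (auto simp: closed_segment_same_Re)
  have "norm (contour_integral (linepath (of_real a) (Complex a h)) f) \<le> V * norm (Complex a h - of_real a)"
    using V'[of _ a] by (intro contour_integral_bound_linepath seg V0) auto
  moreover have "norm (contour_integral (linepath (Complex b h) (of_real b)) f) \<le> V * norm (of_real b - Complex b h)"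
    using V'[of _ b] by (intro contour_integral_bound_linepath seg V0) (auto simp: closed_segment_commute)
  moreover have "norm (contour_integral (linepath (Complex a h) (Complex b h)) f) \<le> U * norm (Complex b h - Complex a h)"
  proof (intro contour_integral_bound_linepath seg U0)
    fix z assume "z \<in> closed_segment (Complex a h) (Complex b h)"
    then show "norm (f z) \<le> U"
      using U[of "Re z"] ab by (cases z) (auto simp: closed_segment_same_Im closed_segment_eq_real_ivl)
  qed
  moreover have "norm (Complex a h - of_real a) = \<bar>h\<bar>" "norm (of_real b - Complex b h) = \<bar>h\<bar>"
    "norm (Complex b h - Complex a h) = b - a"
    using ab by (simp_all add: cmod_def)
  ultimately show ?thesis
    unfolding contour_integral_detour[OF f]
    by (intro order.trans[OF norm_triangle_ineq] order.trans[OF add_mono[OF norm_triangle_ineq order_refl]])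
       (simp add: algebra_simps)
qed

section \<open>The integrand and the phase in the right half-plane\<close>

definition Z_ext :: "complex \<Rightarrow> complex" where
  "Z_ext t = exp (\<i> * Theta t) * zeta (1/2 + \<i> * t)"

text \<open>The factor \<open>Theta'\<close> cancels the derivative of the phase in the residues and
  so leaves the values of Z unweighted.\<close>

definition Z_form :: "complex \<Rightarrow> complex" where
  "Z_form t = Theta' t * Z_ext t"

definition gram_phase :: "real \<Rightarrow> complex \<Rightarrow> complex" where
  "gram_phase \<tau> t = exp (- 2 * \<i> * (Theta t - of_real \<tau>))"

lemma Z_ext_of_real: "Z_ext (of_real x) = hardy_Z x"
  by (simp add: Z_ext_def hardy_Z_def Theta_of_real cis_conv_exp)

lemma norm_gram_phase: "norm (gram_phase \<tau> t) = exp (2 * Im (Theta t))"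
  by (simp add: gram_phase_def)

lemma Theta_holomorphic: "Theta holomorphic_on {t. Re t > 0}"
  using has_field_derivative_Theta
  by (auto simp: holomorphic_on_open open_halfspace_Re_gt)

lemma Theta'_holomorphic: "Theta' holomorphic_on {t. Re t > 0}"
proof -
  have "deriv Theta holomorphic_on {t. Re t > 0}"
    by (intro holomorphic_deriv Theta_holomorphic open_halfspace_Re_gt)
  then show ?thesis
    by (rule holomorphic_transform) (auto intro!: DERIV_imp_deriv has_field_derivative_Theta)
qed

lemma Z_ext_holomorphic: "Z_ext holomorphic_on {t. Re t > 0}"
proof -
  have "(zeta \<circ> (\<lambda>t. 1/2 + \<i> * t)) holomorphic_on {t. Re t > 0}"
    by (rule holomorphic_on_compose_gen[OF _ zeta_holomorphic])
       (auto intro!: holomorphic_intros simp: complex_eq_iff)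
  then show ?thesis
    unfolding Z_ext_def o_def by (intro holomorphic_intros Theta_holomorphic)
qed

lemma Z_form_holomorphic: "Z_form holomorphic_on {t. Re t > 0}"
  unfolding Z_form_def by (intro holomorphic_intros Theta'_holomorphic Z_ext_holomorphic)

lemma gram_phase_holomorphic: "gram_phase \<tau> holomorphic_on {t. Re t > 0}"
  unfolding gram_phase_def by (intro holomorphic_intros Theta_holomorphic)

text \<open>One primitive serves all \<tau>, T and H, so the main terms for different \<tau> differ
  only in the points at which it is evaluated. It exists because the half-plane is convex.\<close>

lemma Z_form_primitive:
  obtains G where "\<And>t. Re t > 0 \<Longrightarrow> (G has_field_derivative Z_form t) (at t)"
proof -
  have "convex {t::complex. Re t > 0}" "open {t::complex. Re t > 0}"
    by (rule convex_halfspace_Re_gt open_halfspace_Re_gt)+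
  from holomorphic_convex_primitive'[OF this Z_form_holomorphic] obtain G
    where "\<And>t. t \<in> {t. Re t > 0} \<Longrightarrow> (G has_field_derivative Z_form t) (at t within {t. Re t > 0})" by blast
  then show ?thesis
    using that[of G] by (simp add: at_within_open[OF _ open_halfspace_Re_gt])
qed

text \<open>The modulus of the phase is exp (2 Im Theta), and Im Theta = c * Im t with c > 0;
  modulus 1 therefore forces t onto the real axis. There the phase is 1 only if \<theta> - \<tau> is
  a multiple of pi.\<close>

lemma gram_phase_eq_1D:
  assumes t: "Re t \<ge> exp 8" "\<bar>Im t\<bar> \<le> 4" and 1: "gram_phase \<tau> t = 1"
  shows "\<exists>k::int. Im t = 0 \<and> RS_theta (Re t) = pi * of_int k + \<tau>"
proof -
  have ln: "ln (Re t) \<ge> 8"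
    using t less_le_trans[OF exp_gt_zero t(1)] by (simp add: ln_ge_iff)
  obtain c where c: "c \<ge> ln (Re t) / 2 - 3" "Im (Theta t) = Im t * c"
    using Theta_vertical(1)[OF t] by auto
  have "exp (2 * Im (Theta t)) = 1" using 1 norm_gram_phase[of \<tau> t] by simp
  then have "Im t * c = 0" using c by simp
  moreover have "c > 0" using c ln by simp
  ultimately have im: "Im t = 0" by simp
  then have t_eq: "t = of_real (Re t)" by (simp add: complex_eq_iff)
  obtain n :: int where "Im (- 2 * \<i> * (Theta t - of_real \<tau>)) = of_int (2 * n) * pi"
    using 1 unfolding gram_phase_def exp_eq_1 by blast
  then have "RS_theta (Re t) = pi * of_int (- n) + \<tau>"
    using Theta_of_real[of "Re t"] t_eq by (simp add: algebra_simps)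
  then show ?thesis using im by blast
qed

lemma RS_theta_le_cancel:
  assumes "exp 8 \<le> x" "exp 8 \<le> y" "RS_theta x \<le> RS_theta y"
  shows "x \<le> y"
  using RS_theta_expanding[of y x] assms by (cases "x \<le> y") auto

section \<open>Gram points as poles\<close>

text \<open>Where w = 1, the derivative of 1 - w is 2 \<i> Theta', so the pole is at most simple and
  Theta' cancels. Multiplied by 2 pi \<i>, the residue yields pi * Z.\<close>

lemma residue_Z_form:
  assumes p: "p \<in> D" "open D" "D \<subseteq> {t. Re t > 0}" and one: "gram_phase \<tau> p = 1"
    and ne: "\<And>t. t \<in> D \<Longrightarrow> t \<noteq> p \<Longrightarrow> gram_phase \<tau> t \<noteq> 1" and nz: "Theta' p \<noteq> 0"
  shows "residue (\<lambda>t. Z_form t / (1 - gram_phase \<tau> t)) p = Z_ext p / (2 * \<i>)"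
proof (rule residue_simple'[OF p(2,1)])
  have Re: "Re p > 0" using p by auto
  show "(\<lambda>t. Z_form t / (1 - gram_phase \<tau> t)) holomorphic_on D - {p}"
    using ne p(3)
    by (intro holomorphic_intros holomorphic_on_subset[OF Z_form_holomorphic]
          holomorphic_on_subset[OF gram_phase_holomorphic]) (force dest: sym)+
  have "((\<lambda>t. 1 - gram_phase \<tau> t) has_field_derivative 2 * \<i> * Theta' p) (at p)"
    using one unfolding gram_phase_def
    by (auto intro!: derivative_eq_intros has_field_derivative_Theta[OF Re])
  then have "((\<lambda>t. (1 - gram_phase \<tau> t) / (t - p)) \<longlongrightarrow> 2 * \<i> * Theta' p) (at p)"
    using one by (simp add: has_field_derivative_iff)
  moreover have "(Z_form \<longlongrightarrow> Z_form p) (at p)"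
  proof -
    have "continuous_on {t. Re t > 0} Z_form"
      by (rule holomorphic_on_imp_continuous_on[OF Z_form_holomorphic])
    then have "isCont Z_form p"
      using Re by (simp add: continuous_on_eq_continuous_at open_halfspace_Re_gt)
    then show ?thesis by (simp add: isCont_def)
  qed
  ultimately have "((\<lambda>t. Z_form t / ((1 - gram_phase \<tau> t) / (t - p))) \<longlongrightarrow> Z_form p / (2 * \<i> * Theta' p)) (at p)"
    using nz by (intro tendsto_divide) auto
  then show "((\<lambda>t. Z_form t / (1 - gram_phase \<tau> t) * (t - p)) \<longlongrightarrow> Z_ext p / (2 * \<i>)) (at p)"
    using nz by (simp add: Z_form_def)
qed

text \<open>The residue theorem on the rectangle, combined with 1/(1-w) = 1 + w/(1-w) on its lower
  half, where the summand 1 integrates to the difference of G. The continuity claims are what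
  \<open>contour_integral_detour_bound\<close> asks for.\<close>

lemma gram_sum_contour:
  fixes A B :: int and S :: "int \<Rightarrow> real"
  assumes a: "a > exp 8" "RS_theta a = pi * of_int A + \<tau> - pi / 2"
    and b: "b > exp 8" "RS_theta b = pi * of_int B + \<tau> + pi / 2"
    and AB: "A \<le> B"
    and S: "\<And>\<nu>. \<nu> \<in> {A..B} \<Longrightarrow> S \<nu> \<ge> exp 8" "\<And>\<nu>. \<nu> \<in> {A..B} \<Longrightarrow> RS_theta (S \<nu>) = pi * of_int \<nu> + \<tau>"
    and G: "\<And>t. Re t > 0 \<Longrightarrow> (G has_field_derivative Z_form t) (at t)"
  shows "of_real pi * (\<Sum>\<nu>\<in>{A..B}. hardy_Z (S \<nu>)) = G (of_real b) - G (of_real a) +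
           contour_integral (detour a b (-3)) (\<lambda>t. Z_form t * gram_phase \<tau> t / (1 - gram_phase \<tau> t)) -
           contour_integral (detour a b 3) (\<lambda>t. Z_form t / (1 - gram_phase \<tau> t))"
    and "continuous_on (path_image (detour a b (-3))) (\<lambda>t. Z_form t * gram_phase \<tau> t / (1 - gram_phase \<tau> t))"
    and "continuous_on (path_image (detour a b 3)) (\<lambda>t. Z_form t / (1 - gram_phase \<tau> t))"
    and "a \<le> b"
proof -
  define F where "F = (\<lambda>t. Z_form t / (1 - gram_phase \<tau> t))"
  have \<theta>ab: "RS_theta a \<le> RS_theta b"
  proof -
    have "pi * of_int A \<le> pi * of_int B" using AB by simp
    then show ?thesis using a b pi_gt_zero by linarith
  qed
  show ab: "a \<le> b"
    by (rule RS_theta_le_cancel[OF less_imp_le[OF a(1)] less_imp_le[OF b(1)] \<theta>ab])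
  have near: "\<exists>r>0. \<forall>x. \<bar>x - c\<bar> < r \<longrightarrow> \<bar>RS_theta x - RS_theta c\<bar> < pi / 2" for c
  proof -
    have "\<forall>e>0. \<exists>d>0. \<forall>x. dist x c < d \<longrightarrow> dist (RS_theta x) (RS_theta c) < e"
      using continuous_RS_theta unfolding continuous_on_iff by simp
    then show ?thesis using pi_half_gt_zero unfolding dist_real_def by blast
  qed
  obtain r1 where r1: "r1 > 0" "\<And>x. \<bar>x - a\<bar> < r1 \<Longrightarrow> \<bar>RS_theta x - RS_theta a\<bar> < pi / 2"
    using near[of a] by blast
  obtain r2 where r2: "r2 > 0" "\<And>x. \<bar>x - b\<bar> < r2 \<Longrightarrow> \<bar>RS_theta x - RS_theta b\<bar> < pi / 2"
    using near[of b] by blast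
  \<comment> \<open>The residue theorem is applied on an open D around the rectangle. In the margin
    r the phase \<theta> moves by less than pi/2, so no further zeros of 1 - w enter, and Re t > exp
    8 is preserved.\<close>
  define r where "r = min (min r1 r2) (a - exp 8)"
  have r: "r > 0" "r \<le> r1" "r \<le> r2" "a - r \<ge> exp 8" using r1 r2 a by (auto simp: r_def)
  define D where "D = box (Complex (a - r) (-4)) (Complex (b + r) 4)"
  have D: "t \<in> D \<longleftrightarrow> a - r < Re t \<and> Re t < b + r \<and> \<bar>Im t\<bar> < 4" for t
    by (auto simp: D_def in_box_complex_iff)
  have Dge: "Re t > exp 8" if "t \<in> D" for t using that r by (simp add: D)
  then have Dpos: "D \<subseteq> {t. Re t > 0}" using less_trans[OF exp_gt_zero] by blast
  define P where "P = (\<lambda>\<nu>. complex_of_real (S \<nu>)) ` {A..B}"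
  have Sab: "a < S \<nu>" "S \<nu> < b" if "\<nu> \<in> {A..B}" for \<nu>
  proof -
    have i: "pi * of_int A \<le> pi * of_int \<nu>" "pi * of_int \<nu> \<le> pi * of_int B" using that by auto
    have st: "RS_theta a < RS_theta (S \<nu>)" "RS_theta (S \<nu>) < RS_theta b"
      unfolding S(2)[OF that] a(2) b(2) using i pi_gt_zero by linarith+
    then have "a \<le> S \<nu>" "S \<nu> \<le> b"
      using RS_theta_le_cancel[OF less_imp_le[OF a(1)] S(1)[OF that]]
        RS_theta_le_cancel[OF S(1)[OF that] less_imp_le[OF b(1)]] by (simp_all add: less_imp_le)
    moreover have "a \<noteq> S \<nu>" "S \<nu> \<noteq> b"
      using st by blast+
    ultimately show "a < S \<nu>" "S \<nu> < b" by auto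
  qed
  have one: "gram_phase \<tau> (of_real (S \<nu>)) = 1" if "\<nu> \<in> {A..B}" for \<nu>
  proof -
    have "- 2 * \<i> * (Theta (of_real (S \<nu>)) - of_real \<tau>) = (2 * of_int (-\<nu>) * of_real pi) * \<i>"
      using S(2)[OF that] by (simp add: Theta_of_real)
    then have "gram_phase \<tau> (of_real (S \<nu>)) = exp ((2 * of_int (-\<nu>) * of_real pi) * \<i>)"
      unfolding gram_phase_def by (simp only:)
    also have "\<dots> = 1" unfolding exp_eq_1 by (auto intro!: exI[of _ "-\<nu>"])
    finally show ?thesis .
  qed
  have zeros: "t \<in> P" if t: "t \<in> D" "gram_phase \<tau> t = 1" for t
  proof -
    obtain k :: int where k: "Im t = 0" "RS_theta (Re t) = pi * of_int k + \<tau>"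
      using gram_phase_eq_1D[of t \<tau>] t Dge[OF t(1)] by (auto simp: D)
    have t8: "exp 8 \<le> Re t" using Dge[OF t(1)] by simp
    \<comment> \<open>The margin costs less than pi/2 on top of the offset pi/2 of a. Hence k > A -
      1, which for integers is k \<ge> A; the bound at b is symmetric.\<close>
    have "RS_theta (Re t) > RS_theta a - pi / 2"
    proof (cases "Re t < a")
      case True
      then have "\<bar>Re t - a\<bar> < r1" using t r by (simp add: D)
      then show ?thesis using r1(2)[of "Re t"] by linarith
    next
      case False
      then show ?thesis using RS_theta_expanding[of a "Re t"] a(1) pi_gt_zero by linarith
    qed
    then have "pi * (of_int A - 1) < pi * of_int k" using k a by (simp add: algebra_simps)
    then have "real_of_int A - 1 < of_int k" by simp
    moreover have "RS_theta (Re t) < RS_theta b + pi / 2"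
    proof (cases "Re t > b")
      case True
      then have "\<bar>Re t - b\<bar> < r2" using t r by (simp add: D)
      then show ?thesis using r2(2)[of "Re t"] by linarith
    next
      case False
      then show ?thesis using RS_theta_expanding[of "Re t" b] t8 pi_gt_zero by linarith
    qed
    then have "pi * of_int k < pi * (of_int B + 1)" using k b by (simp add: algebra_simps)
    then have "real_of_int k < of_int B + 1" by simp
    ultimately have kAB: "k \<in> {A..B}" by auto
    have "Re t = S k"
      using RS_theta_le_cancel[of "Re t" "S k"] RS_theta_le_cancel[of "S k" "Re t"] t8 S[OF kAB] k
      by simp
    then have "t = of_real (S k)" using k by (simp add: complex_eq_iff)
    then show ?thesis using kAB by (auto simp: P_def)
  qed
  have PD: "P \<subseteq> D" using Sab r by (force simp: P_def D)
  have oneP: "gram_phase \<tau> p = 1" if "p \<in> P" for p using that one by (auto simp: P_def)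
  have finP: "finite P" by (simp add: P_def)
  have openD: "open D" by (simp add: D_def open_box)
  have holF: "F holomorphic_on D - P"
    unfolding F_def using zeros Dpos
    by (intro holomorphic_intros holomorphic_on_subset[OF Z_form_holomorphic]
          holomorphic_on_subset[OF gram_phase_holomorphic]) (force dest: sym)+
  let ?R = "rectpath (Complex a (-3)) (Complex b 3)"
  have imR: "path_image ?R \<subseteq> D - P"
    using Sab r ab by (subst path_image_rectpath) (force simp: D P_def)+
  have "contour_integral ?R F = 2 * pi * \<i> * (\<Sum>p\<in>P. winding_number ?R p * residue F p)"
  proof (rule Residue_theorem[OF openD _ finP holF _ _ imR])
    show "connected D" by (simp add: D_def convex_connected)
    show "\<forall>z. z \<notin> D \<longrightarrow> winding_number ?R z = 0"
    proof (intro allI impI)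
      fix z assume "z \<notin> D"
      then show "winding_number ?R z = 0"
        using r ab by (intro winding_number_rectpath_outside) (auto simp: D in_cbox_complex_iff)
    qed
  qed auto
  also have "(\<Sum>p\<in>P. winding_number ?R p * residue F p) = (\<Sum>p\<in>P. Z_ext p / (2 * \<i>))"
  proof (rule sum.cong[OF refl])
    fix p assume p: "p \<in> P"
    then obtain \<nu> where \<nu>: "p = of_real (S \<nu>)" "\<nu> \<in> {A..B}" by (auto simp: P_def)
    have "winding_number ?R p = 1"
      using \<nu> Sab by (intro winding_number_rectpath) (auto simp: in_box_complex_iff)
    \<comment> \<open>The other poles are removed from D so that p is the only zero of 1 - w in the
      domain.\<close>
    moreover have "residue F p = Z_ext p / (2 * \<i>)"
      unfolding F_def
    proof (rule residue_Z_form[where D = "D - (P - {p})"])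
      show "open (D - (P - {p}))" using openD finP by (intro open_Diff finite_imp_closed) auto
      have "ln (Re p) \<ge> 8"
        using S(1)[OF \<nu>(2)] \<nu>(1) less_le_trans[OF exp_gt_zero S(1)[OF \<nu>(2)]] by (simp add: ln_ge_iff)
      then have "Re (Theta' p) > 0"
        using Theta'_bounds(1)[of p] S(1)[OF \<nu>(2)] \<nu>(1) by simp
      then show "Theta' p \<noteq> 0" by auto
    qed (use p PD Dpos oneP zeros in auto)
    ultimately show "winding_number ?R p * residue F p = Z_ext p / (2 * \<i>)" by simp
  qed
  also have "\<dots> = (\<Sum>\<nu>\<in>{A..B}. Z_ext (of_real (S \<nu>)) / (2 * \<i>))"
    unfolding P_def
  proof (subst sum.reindex)
    show "inj_on (\<lambda>\<nu>. complex_of_real (S \<nu>)) {A..B}"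
    proof (rule inj_onI)
      fix x y assume xy: "x \<in> {A..B}" "y \<in> {A..B}" "complex_of_real (S x) = of_real (S y)"
      then have "RS_theta (S x) = RS_theta (S y)" by simp
      then have "pi * of_int x = pi * of_int y"
        unfolding S(2)[OF xy(1)] S(2)[OF xy(2)] by simp
      then show "x = y" by simp
    qed
  qed (simp add: o_def)
  also have "2 * pi * \<i> * \<dots> = of_real pi * (\<Sum>\<nu>\<in>{A..B}. hardy_Z (S \<nu>))"
    by (simp add: Z_ext_of_real sum_distrib_left sum_divide_distrib[symmetric])
  finally have res: "contour_integral ?R F = of_real pi * (\<Sum>\<nu>\<in>{A..B}. hardy_Z (S \<nu>))" .
  have contF: "continuous_on (path_image ?R) F"
    by (rule continuous_on_subset[OF holomorphic_on_imp_continuous_on[OF holF] imR])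
  have split: "contour_integral ?R F = contour_integral (detour a b (-3)) F - contour_integral (detour a b 3) F"
    by (rule contour_integral_rectpath_detour[OF _ ab contF]) simp
  have imd: "path_image (detour a b h) \<subseteq> path_image ?R" if "h \<in> {-3, 3}" for h
    unfolding path_image_detour using that ab
    by (subst path_image_rectpath)
       (auto simp: closed_segment_same_Re closed_segment_same_Im closed_segment_eq_real_ivl)
  have imdD: "path_image (detour a b h) \<subseteq> D - P" if "h \<in> {-3, 3}" for h
    using imd[OF that] imR by blast
  show c3: "continuous_on (path_image (detour a b 3)) (\<lambda>t. Z_form t / (1 - gram_phase \<tau> t))"
    using continuous_on_subset[OF contF imd[of 3]] by (simp add: F_def)
  have holW: "(\<lambda>t. Z_form t * gram_phase \<tau> t / (1 - gram_phase \<tau> t)) holomorphic_on D - P"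
    using zeros Dpos
    by (intro holomorphic_intros holomorphic_on_subset[OF Z_form_holomorphic]
          holomorphic_on_subset[OF gram_phase_holomorphic]) (force dest: sym)+
  from continuous_on_subset[OF holomorphic_on_imp_continuous_on[OF holW] imdD[of "-3"]]
  show cm3: "continuous_on (path_image (detour a b (-3))) (\<lambda>t. Z_form t * gram_phase \<tau> t / (1 - gram_phase \<tau> t))"
    by simp
  have intW: "(\<lambda>t. Z_form t * gram_phase \<tau> t / (1 - gram_phase \<tau> t)) contour_integrable_on detour a b (-3)"
  proof (rule contour_integrable_holomorphic_simple[OF holW])
    show "open (D - P)" using openD finP by (intro open_Diff finite_imp_closed)
    show "path_image (detour a b (-3)) \<subseteq> D - P" by (rule imdD) simp
  qed simp
  have prim: "(Z_form has_contour_integral (G (of_real b) - G (of_real a))) (detour a b (-3))"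
  proof -
    have "(Z_form has_contour_integral
        (G (pathfinish (detour a b (-3))) - G (pathstart (detour a b (-3))))) (detour a b (-3))"
    proof (rule contour_integral_primitive[where S = "{t. Re t > 0}" and f = G and f' = Z_form])
      show "(G has_field_derivative Z_form t) (at t within {t. Re t > 0})" if "t \<in> {t. Re t > 0}" for t
        using that by (simp add: has_field_derivative_at_within[OF G])
      have "path_image (detour a b (-3)) \<subseteq> D - P" by (rule imdD) simp
      then show "path_image (detour a b (-3)) \<subseteq> {t. Re t > 0}" using Dpos by blast
    qed simp
    then show ?thesis by simp
  qed
  have "contour_integral (detour a b (-3)) F = contour_integral (detour a b (-3))
      (\<lambda>t. Z_form t + Z_form t * gram_phase \<tau> t / (1 - gram_phase \<tau> t))"
  proof (rule contour_integral_eq)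
    fix t assume "t \<in> path_image (detour a b (-3))"
    then have "gram_phase \<tau> t \<noteq> 1" using imdD[of "-3"] zeros by auto
    then show "F t = Z_form t + Z_form t * gram_phase \<tau> t / (1 - gram_phase \<tau> t)"
      by (simp add: F_def field_simps)
  qed
  also have "\<dots> = (G (of_real b) - G (of_real a)) +
      contour_integral (detour a b (-3)) (\<lambda>t. Z_form t * gram_phase \<tau> t / (1 - gram_phase \<tau> t))"
    using has_contour_integral_add[OF prim has_contour_integral_integral[OF intW]]
    by (rule contour_integral_unique)
  finally show "of_real pi * (\<Sum>\<nu>\<in>{A..B}. hardy_Z (S \<nu>)) = G (of_real b) - G (of_real a) +
           contour_integral (detour a b (-3)) (\<lambda>t. Z_form t * gram_phase \<tau> t / (1 - gram_phase \<tau> t)) -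
           contour_integral (detour a b 3) (\<lambda>t. Z_form t / (1 - gram_phase \<tau> t))"
    using res split by (simp add: F_def)
qed

section \<open>Bounds on the contour\<close>

lemma norm_Z_form:
  "norm (Z_form (Complex x y)) = norm (Theta' (Complex x y)) *
     (exp (- Im (Theta (Complex x y))) * norm (zeta (Complex (1/2 - y) x)))"
proof -
  have "1/2 + \<i> * Complex x y = Complex (1/2 - y) x" by (simp add: complex_eq_iff)
  then show ?thesis by (simp add: Z_form_def Z_ext_def norm_mult)
qed

text \<open>The vertical sides of the contour stand at points where the phase is \<open>-1\<close>, far from its value \<open>1\<close> at the poles.\<close>
lemma Re_gram_phase_nonpos:
  assumes x: "x \<ge> exp 8" and y: "\<bar>y\<bar> \<le> 3" and cos: "cos (2 * (RS_theta x - \<tau>)) = -1"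
  shows "Re (gram_phase \<tau> (Complex x y)) \<le> 0"
proof -
  define r where "r = Re (Theta (Complex x y)) - RS_theta x"
  have "\<bar>r\<bar> \<le> \<bar>y\<bar> / 8" unfolding r_def using x y by (intro Theta_vertical(2)) auto
  \<comment> \<open>Up to height 3 the argument of w turns by at most 3/4 away from that of -1, less
    than a quarter turn.\<close>
  then have r: "\<bar>2 * r\<bar> \<le> pi / 2" using y pi_gt3 by linarith
  have "sin (2 * (RS_theta x - \<tau>)) = 0"
    using sin_cos_squared_add[of "2 * (RS_theta x - \<tau>)"] unfolding cos by simp
  then have "cos (2 * (RS_theta x - \<tau>) + 2 * r) = - cos (2 * r)"
    unfolding cos_add cos by simp
  also have "2 * (RS_theta x - \<tau>) + 2 * r = 2 * (Re (Theta (Complex x y)) - \<tau>)"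
    by (simp add: r_def)
  finally have "cos (2 * (Re (Theta (Complex x y)) - \<tau>)) = - cos (2 * r)" .
  have "Re (gram_phase \<tau> (Complex x y)) = - (exp (2 * Im (Theta (Complex x y))) * cos (2 * r))"
  proof -
    have "Im (- 2 * \<i> * (Theta (Complex x y) - of_real \<tau>)) = - (2 * (Re (Theta (Complex x y)) - \<tau>))"
      by simp
    with \<open>cos (2 * (Re (Theta (Complex x y)) - \<tau>)) = - cos (2 * r)\<close> show ?thesis
      unfolding gram_phase_def Re_exp by (simp only: cos_minus) simp
  qed
  moreover have "cos (2 * r) \<ge> 0" using r by (intro cos_ge_zero) auto
  ultimately show ?thesis by simp
qed

text \<open>The distance from 1 to a point of the left half-plane exceeds both 1 and its modulus.
  The first bound serves below the axis, where the numerator contains w; the second serves above it,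
  where the decay of 1/w is wanted.\<close>

lemma norm_one_minus_ge:
  fixes w :: complex
  assumes "Re w \<le> 0"
  shows "1 \<le> norm (1 - w)" "norm w \<le> norm (1 - w)"
proof -
  show "1 \<le> norm (1 - w)" using assms complex_Re_le_cmod[of "1 - w"] by simp
  show "norm w \<le> norm (1 - w)"
  proof (rule power2_le_imp_le)
    show "(norm w)\<^sup>2 \<le> (norm (1 - w))\<^sup>2"
      using assms by (simp add: cmod_power2 power2_diff)
  qed simp
qed

text \<open>By \<open>Theta_vertical\<close> the rate is at least ln x / 2 - 3. The summand 3 costs
  exp (3 v) \<le> exp 9; the last two claims rest on the rate being at least 1.\<close>

lemma Im_Theta_bounds:
  assumes x: "x \<ge> exp 8" and v: "0 \<le> v" "v \<le> 3"
  shows "exp (- Im (Theta (Complex x v))) \<le> exp 9 * x powr (- v / 2)"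
    and "exp (Im (Theta (Complex x (- v)))) \<le> exp 9 * x powr (- v / 2)"
    and "Im (Theta (Complex x v)) \<ge> v" and "Im (Theta (Complex x (- v))) \<le> - v"
proof -
  have x0: "x > 0" using x less_le_trans[OF exp_gt_zero] by blast
  have ln: "ln x \<ge> 8" using x x0 by (simp add: ln_ge_iff)
  obtain c where c: "c \<ge> ln x / 2 - 3" "Im (Theta (Complex x v)) = v * c"
    using Theta_vertical(1)[OF x, of v] v by auto
  obtain d where d: "d \<ge> ln x / 2 - 3" "Im (Theta (Complex x (-v))) = - v * d"
    using Theta_vertical(1)[OF x, of "-v"] v by auto
  have key: "exp (- (v * c)) \<le> exp 9 * x powr (- v / 2)" if "c \<ge> ln x / 2 - 3" for c
  proof -
    have "v * (ln x / 2 - 3) \<le> v * c" using v that by (intro mult_left_mono) auto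
    then have "- (v * c) \<le> 9 + (- v / 2) * ln x" using v by (simp add: algebra_simps)
    then have "exp (- (v * c)) \<le> exp (9 + (- v / 2) * ln x)" by simp
    then show ?thesis using x0 by (simp only: powr_def exp_add split: if_splits) auto
  qed
  show "exp (- Im (Theta (Complex x v))) \<le> exp 9 * x powr (- v / 2)"
    unfolding c(2) by (rule key[OF c(1)])
  show "exp (Im (Theta (Complex x (- v)))) \<le> exp 9 * x powr (- v / 2)"
    unfolding d(2) using key[OF d(1)] by simp
  have "c \<ge> 1" "d \<ge> 1" using c d ln by auto
  then show "Im (Theta (Complex x v)) \<ge> v" "Im (Theta (Complex x (- v))) \<le> - v"
    unfolding c(2) d(2) using v mult_left_mono[of 1 c v] mult_left_mono[of 1 d v] by auto
qed

text \<open>In the exponent 2 \<delta> on the vertical sides one \<delta> pays for the logarithm in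
  Theta', the other for zeta. On the horizontal sides |w| is far from 1 whatever \<tau> is, and the
  exponents come out as 2 \<delta> - 3/2 below and \<delta> - 1/2 above, both at most -1/6.\<close>

lemma contour_estimates:
  assumes "lindelof_hypothesis" and \<delta>: "0 < \<delta>" "\<delta> \<le> 1/6"
  obtains K X where "K \<ge> 0" "X \<ge> exp 8"
    "\<And>x. x \<ge> X \<Longrightarrow> norm (Z_form (of_real x)) \<le> K * x powr (2 * \<delta>)"
    "\<And>x v \<tau>. x \<ge> X \<Longrightarrow> 0 \<le> v \<Longrightarrow> v \<le> 3 \<Longrightarrow> cos (2 * (RS_theta x - \<tau>)) = -1 \<Longrightarrow>
       norm (Z_form (Complex x (-v)) * gram_phase \<tau> (Complex x (-v)) / (1 - gram_phase \<tau> (Complex x (-v)))) \<le> K * x powr (2 * \<delta>)"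
    "\<And>x v \<tau>. x \<ge> X \<Longrightarrow> 0 \<le> v \<Longrightarrow> v \<le> 3 \<Longrightarrow> cos (2 * (RS_theta x - \<tau>)) = -1 \<Longrightarrow>
       norm (Z_form (Complex x v) / (1 - gram_phase \<tau> (Complex x v))) \<le> K * x powr (2 * \<delta>)"
    "\<And>x \<tau>. x \<ge> X \<Longrightarrow>
       norm (Z_form (Complex x (-3)) * gram_phase \<tau> (Complex x (-3)) / (1 - gram_phase \<tau> (Complex x (-3)))) \<le> K * x powr (-1/6)"
    "\<And>x \<tau>. x \<ge> X \<Longrightarrow>
       norm (Z_form (Complex x 3) / (1 - gram_phase \<tau> (Complex x 3))) \<le> K * x powr (-1/6)"
proof -
  obtain C where C: "C \<ge> 0"
    "\<forall>\<^sub>F t in at_top. \<forall>u\<in>{0..3}. norm (zeta (Complex (1/2 + u) t)) \<le> C * t powr \<delta>"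
    "\<forall>\<^sub>F t in at_top. \<forall>u\<in>{0..3}. norm (zeta (Complex (1/2 - u) t)) \<le> C * t powr (\<delta> + 3/2 * u)"
    "\<forall>\<^sub>F t in at_top. norm (zeta (Complex (-5/2) t)) \<le> C * t powr 4"
    by (rule lindelof_strip[OF assms(1) \<delta>(1)])
  have "\<forall>\<^sub>F t in at_top. t \<ge> exp 8 \<and> (\<forall>u\<in>{0..3}. norm (zeta (Complex (1/2 + u) t)) \<le> C * t powr \<delta>) \<and>
    (\<forall>u\<in>{0..3}. norm (zeta (Complex (1/2 - u) t)) \<le> C * t powr (\<delta> + 3/2 * u)) \<and>
    norm (zeta (Complex (-5/2) t)) \<le> C * t powr 4"
    using C(2-4) eventually_ge_at_top[of "exp 8 :: real"] by (intro eventually_conj)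
  then obtain X where X': "\<forall>x\<ge>X. x \<ge> exp 8 \<and> (\<forall>u\<in>{0..3}. norm (zeta (Complex (1/2 + u) x)) \<le> C * x powr \<delta>) \<and>
    (\<forall>u\<in>{0..3}. norm (zeta (Complex (1/2 - u) x)) \<le> C * x powr (\<delta> + 3/2 * u)) \<and>
    norm (zeta (Complex (-5/2) x)) \<le> C * x powr 4"
    unfolding eventually_at_top_linorder ..
  have X: "x \<ge> exp 8"
    "\<And>u. 0 \<le> u \<Longrightarrow> u \<le> 3 \<Longrightarrow> norm (zeta (Complex (1/2 + u) x)) \<le> C * x powr \<delta>"
    "\<And>u. 0 \<le> u \<Longrightarrow> u \<le> 3 \<Longrightarrow> norm (zeta (Complex (1/2 - u) x)) \<le> C * x powr (\<delta> + 3/2 * u)"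
    "norm (zeta (Complex (-5/2) x)) \<le> C * x powr 4" if "x \<ge> X" for x
    using spec[OF X', of x] that by (simp_all only: atLeastAtMost_iff Ball_def simp_thms)
  have x1: "x \<ge> 1" if "x \<ge> X" for x
    using X(1)[OF that] one_le_exp_iff[of "8::real"] by linarith
  \<comment> \<open>Obtained by inserting ln x \<le> x^\<delta> / \<delta> into the bound ln x / 2 +
    4 for Theta'.\<close>
  define K0 where "K0 = 1 / (2 * \<delta>) + 4"
  have K0: "K0 \<ge> 0" using \<delta> by (simp add: K0_def)
  have T': "norm (Theta' (Complex x y)) \<le> K0 * x powr \<delta>" if "x \<ge> X" "\<bar>y\<bar> \<le> 3" for x y
  proof -
    have "norm (Theta' (Complex x y)) \<le> ln x / 2 + 4"
      using Theta'_bounds(3)[of "Complex x y"] X(1)[OF that(1)] that(2) by simp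
    also have "ln x \<le> x powr \<delta> / \<delta>" using ln_powr_bound[OF x1[OF that(1)] \<delta>(1)] .
    also have "x powr \<delta> / \<delta> / 2 + 4 \<le> K0 * x powr \<delta>"
      using ge_one_powr_ge_zero[OF x1[OF that(1)], of \<delta>] \<delta> by (simp add: K0_def algebra_simps)
    finally show ?thesis by simp
  qed
  have pw: "x powr (2 * \<delta>) = x powr \<delta> * x powr \<delta>" for x
    by (simp flip: powr_add)
  define E :: real where "E = exp 27"
  have E: "E \<ge> 1" "exp 9 \<le> E" by (simp_all add: E_def)
  have E3: "exp 9 ^ 3 = E" by (simp add: E_def flip: exp_of_nat_mult)
  define K where "K = 2 * K0 * C * E"
  have K: "K \<ge> 0" using K0 C(1) E by (simp add: K_def)
  have KC: "K0 * C \<le> K" "K0 * C * E \<le> K"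
  proof -
    have "K0 * C * 1 \<le> K0 * C * E" using K0 C(1) E by (intro mult_left_mono) auto
    moreover have "0 \<le> K0 * C * E" using K0 C(1) E by auto
    moreover have "K = K0 * C * E + K0 * C * E" by (simp add: K_def)
    ultimately show "K0 * C \<le> K" "K0 * C * E \<le> K" by linarith+
  qed
  \<comment> \<open>Z contributes exp (- Im Theta) and |w| = exp (2 Im Theta), so the product is exp
    (Im Theta), which is small below the axis. The parameter m bounds |1 - w| from below: 1 on the
    vertical sides, 1/2 on the horizontal one.\<close>
  have lower: "norm (Z_form (Complex x (-v)) * gram_phase \<tau> (Complex x (-v)) / (1 - gram_phase \<tau> (Complex x (-v))))
      \<le> K0 * C * x powr (2 * \<delta>) * (exp (Im (Theta (Complex x (-v)))) / m)"
    if x: "x \<ge> X" and v: "0 \<le> v" "v \<le> 3" and m: "m > 0" "m \<le> norm (1 - gram_phase \<tau> (Complex x (-v)))" for x v \<tau> m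
  proof -
    let ?t = "Complex x (-v)"
    have "norm (Z_form ?t * gram_phase \<tau> ?t / (1 - gram_phase \<tau> ?t)) =
      norm (Theta' ?t) * norm (zeta (Complex (1/2 + v) x)) * (exp (Im (Theta ?t)) / norm (1 - gram_phase \<tau> ?t))"
      unfolding norm_divide norm_mult norm_Z_form norm_gram_phase
      by (simp add: mult_ac flip: exp_add)
    also have "\<dots> \<le> (K0 * x powr \<delta>) * (C * x powr \<delta>) * (exp (Im (Theta ?t)) / m)"
      using x v m K0 C(1) by (intro mult_mono frac_le T' X(2)) auto
    also have "\<dots> = K0 * C * x powr (2 * \<delta>) * (exp (Im (Theta ?t)) / m)"
      unfolding pw by (simp add: mult_ac)
    finally show ?thesis .
  qed
  \<comment> \<open>Division by |w| turns exp (- Im Theta) into its cube, whence E = exp 27 and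
    x^(-3v/2). Here m bounds |1 - w| / |w| from below, and Q is a bound for zeta: the interpolated
    one on the vertical sides, whose x^(3v/2) cancels exactly, and the crude x^4 at v = 3.\<close>
  have upper: "norm (Z_form (Complex x v) / (1 - gram_phase \<tau> (Complex x v)))
      \<le> K0 * x powr \<delta> * Q * (E * x powr (- 3/2 * v) / m)"
    if x: "x \<ge> X" and v: "0 \<le> v" "v \<le> 3" and m: "m > 0" "m * norm (gram_phase \<tau> (Complex x v)) \<le> norm (1 - gram_phase \<tau> (Complex x v))"
      and Q: "norm (zeta (Complex (1/2 - v) x)) \<le> Q" for x v \<tau> m Q
  proof -
    let ?t = "Complex x v"
    have Wpos: "norm (gram_phase \<tau> ?t) > 0" by (simp add: norm_gram_phase)
    have Q0: "Q \<ge> 0" using Q order.trans[OF norm_ge_zero] by blast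
    have "norm (Z_form ?t / (1 - gram_phase \<tau> ?t)) =
      norm (Theta' ?t) * norm (zeta (Complex (1/2 - v) x)) * (exp (- Im (Theta ?t)) / norm (1 - gram_phase \<tau> ?t))"
      unfolding norm_divide norm_Z_form by (simp add: mult_ac)
    also have "\<dots> \<le> (K0 * x powr \<delta>) * Q * (exp (- Im (Theta ?t)) / (m * norm (gram_phase \<tau> ?t)))"
      using x v m K0 Q Q0 Wpos
      by (intro mult_mono frac_le T' mult_pos_pos) auto
    also have "exp (- Im (Theta ?t)) / (m * norm (gram_phase \<tau> ?t)) = exp (- Im (Theta ?t)) ^ 3 / m"
      by (simp add: norm_gram_phase power3_eq_cube mult_ac exp_minus field_simps flip: exp_add)
    also have "exp (- Im (Theta ?t)) ^ 3 \<le> (exp 9 * x powr (- v / 2)) ^ 3"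
      using Im_Theta_bounds(1)[OF X(1)[OF x] v] by (intro power_mono) auto
    also have "(exp 9 * x powr (- v / 2)) ^ 3 = E * x powr (- 3/2 * v)"
      unfolding power_mult_distrib E3 using x1[OF x] by (simp add: powr_power)
    finally show ?thesis
      using m K0 Q0 by (simp add: divide_right_mono mult_left_mono)
  qed
  have small: "x powr e \<le> x powr (-1/6)" if "x \<ge> X" "e \<le> -1/6" for x e
    using x1[OF that(1)] that(2) by (intro powr_mono) auto
  have W3: "exp (-6::real) \<le> 1/2" using exp_ge_add_one_self[of 6] by (simp add: exp_minus field_simps)
  show ?thesis
  proof (rule that[OF K X(1)[OF order_refl]])
    fix x :: real assume x: "x \<ge> X"
    have "norm (Z_form (Complex x 0)) \<le> (K0 * x powr \<delta>) * (1 * (C * x powr \<delta>))"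
      unfolding norm_Z_form using x K0 C(1) Im_Theta_bounds(3)[OF X(1)[OF x], of 0] X(2)[OF x, of 0]
      by (intro mult_mono T') auto
    also have "\<dots> = K0 * C * x powr (2 * \<delta>)" unfolding pw by (simp add: mult_ac)
    also have "\<dots> \<le> K * x powr (2 * \<delta>)" using KC by (intro mult_right_mono) auto
    finally show "norm (Z_form (of_real x)) \<le> K * x powr (2 * \<delta>)" by (simp add: complex_of_real_def)
  next
    fix x v \<tau> :: real assume x: "x \<ge> X" and v: "0 \<le> v" "v \<le> 3" and c: "cos (2 * (RS_theta x - \<tau>)) = -1"
    have W: "Re (gram_phase \<tau> (Complex x y)) \<le> 0" if "\<bar>y\<bar> \<le> 3" for y
      using Re_gram_phase_nonpos[OF X(1)[OF x] that c] .
    have "norm (Z_form (Complex x (-v)) * gram_phase \<tau> (Complex x (-v)) / (1 - gram_phase \<tau> (Complex x (-v))))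
      \<le> K0 * C * x powr (2 * \<delta>) * (exp (Im (Theta (Complex x (-v)))) / 1)"
      using v by (intro lower x norm_one_minus_ge(1) W) auto
    also have "\<dots> \<le> K0 * C * x powr (2 * \<delta>) * 1"
      using Im_Theta_bounds(4)[OF X(1)[OF x] v] v K0 C(1) by (intro mult_left_mono) auto
    also have "\<dots> \<le> K * x powr (2 * \<delta>)" using KC(1) by (simp add: mult_right_mono)
    finally show "norm (Z_form (Complex x (-v)) * gram_phase \<tau> (Complex x (-v)) / (1 - gram_phase \<tau> (Complex x (-v)))) \<le> K * x powr (2 * \<delta>)" .
    have "norm (Z_form (Complex x v) / (1 - gram_phase \<tau> (Complex x v)))
      \<le> K0 * x powr \<delta> * (C * x powr (\<delta> + 3/2 * v)) * (E * x powr (- 3/2 * v) / 1)"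
      using v x X(3)[OF x v] norm_one_minus_ge(2)[OF W[of v]] by (intro upper) auto
    also have "\<dots> = K0 * C * E * (x powr \<delta> * x powr (\<delta> + 3/2 * v) * x powr (- 3/2 * v))"
      by (simp add: mult_ac)
    also have "x powr \<delta> * x powr (\<delta> + 3/2 * v) * x powr (- 3/2 * v) = x powr (2 * \<delta>)"
      by (simp flip: powr_add)
    also have "K0 * C * E * x powr (2 * \<delta>) \<le> K * x powr (2 * \<delta>)" using KC(2) by (simp add: mult_right_mono)
    finally show "norm (Z_form (Complex x v) / (1 - gram_phase \<tau> (Complex x v))) \<le> K * x powr (2 * \<delta>)" .
  next
    fix x \<tau> :: real assume x: "x \<ge> X"
    have lo: "norm (gram_phase \<tau> (Complex x (-3))) \<le> 1/2"
    proof -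
      have "exp (2 * Im (Theta (Complex x (-3)))) \<le> exp (-6)"
        using Im_Theta_bounds(4)[OF X(1)[OF x], of 3] by simp
      then show ?thesis unfolding norm_gram_phase using W3 by linarith
    qed
    then have lo': "1/2 \<le> norm (1 - gram_phase \<tau> (Complex x (-3)))"
      using norm_triangle_ineq2[of 1 "gram_phase \<tau> (Complex x (-3))"] by simp
    have "norm (Z_form (Complex x (-3)) * gram_phase \<tau> (Complex x (-3)) / (1 - gram_phase \<tau> (Complex x (-3))))
      \<le> K0 * C * x powr (2 * \<delta>) * (exp (Im (Theta (Complex x (-3)))) / (1/2))"
      using lo' by (intro lower x) auto
    also have "\<dots> \<le> K0 * C * x powr (2 * \<delta>) * ((E * x powr (-3/2)) / (1/2))"
    proof -
      have "exp (Im (Theta (Complex x (-3)))) \<le> exp 9 * x powr (-3/2)"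
        using Im_Theta_bounds(2)[OF X(1)[OF x], of 3] by simp
      also have "\<dots> \<le> E * x powr (-3/2)" using E by (intro mult_right_mono) auto
      finally show ?thesis using K0 C(1) by (intro mult_left_mono divide_right_mono) auto
    qed
    also have "\<dots> = K * x powr (2 * \<delta> - 3/2)"
      by (simp add: K_def powr_diff powr_minus_divide)
    also have "\<dots> \<le> K * x powr (-1/6)" using \<delta> K by (intro mult_left_mono small x) auto
    finally show "norm (Z_form (Complex x (-3)) * gram_phase \<tau> (Complex x (-3)) / (1 - gram_phase \<tau> (Complex x (-3)))) \<le> K * x powr (-1/6)" .
    have "norm (gram_phase \<tau> (Complex x 3)) \<ge> 2"
    proof -
      have "exp 6 \<le> exp (2 * Im (Theta (Complex x 3)))"
        using Im_Theta_bounds(3)[OF X(1)[OF x], of 3] by simp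
      then show ?thesis unfolding norm_gram_phase using exp_ge_add_one_self[of "6::real"] by linarith
    qed
    then have up: "1/2 * norm (gram_phase \<tau> (Complex x 3)) \<le> norm (1 - gram_phase \<tau> (Complex x 3))"
      using norm_triangle_ineq2[of "gram_phase \<tau> (Complex x 3)" 1] by (simp add: norm_minus_commute)
    have "norm (Z_form (Complex x 3) / (1 - gram_phase \<tau> (Complex x 3)))
      \<le> K0 * x powr \<delta> * (C * x powr 4) * (E * x powr (- 3/2 * 3) / (1/2))"
      using X(4)[OF x] by (intro upper x up) auto
    also have "\<dots> = K * (x powr \<delta> * x powr 4 * x powr (- 3/2 * 3))"
      by (simp add: K_def mult_ac)
    also have "x powr \<delta> * x powr 4 * x powr (- 3/2 * 3) = x powr (\<delta> - 1/2)"
      by (simp flip: powr_add)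
    also have "K * x powr (\<delta> - 1/2) \<le> K * x powr (-1/6)" using \<delta> K by (intro mult_left_mono small x) auto
    finally show "norm (Z_form (Complex x 3) / (1 - gram_phase \<tau> (Complex x 3))) \<le> K * x powr (-1/6)" .
  qed
qed

section \<open>Comparison of the two sums\<close>

lemma RS_theta_inverse:
  assumes "RS_theta Y \<le> y"
  obtains x where "x \<ge> Y" "RS_theta x = y"
proof -
  have "\<forall>\<^sub>F t in at_top. RS_theta t \<ge> y \<and> t \<ge> Y"
    using filterlim_RS_theta by (intro eventually_conj eventually_ge_at_top) (simp add: filterlim_at_top)
  then obtain b where "RS_theta b \<ge> y" "b \<ge> Y"
    by (auto simp: eventually_at_top_linorder)
  then have "\<exists>x\<ge>Y. x \<le> b \<and> RS_theta x = y"
    using assms by (intro IVT' continuous_on_subset[OF continuous_RS_theta]) auto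
  then show ?thesis using that by blast
qed

text \<open>The greatest solution dominates the one beyond Y that the intermediate value theorem
  supplies.\<close>

lemma gram_t_ge:
  assumes "RS_theta Y \<ge> 0" "RS_theta Y \<le> pi * of_int \<nu> + \<tau>"
  shows "gram_t \<nu> \<tau> \<ge> Y" "RS_theta (gram_t \<nu> \<tau>) = pi * of_int \<nu> + \<tau>"
proof -
  have nn: "pi * of_int \<nu> + \<tau> \<ge> 0" using assms by simp
  obtain x where "x \<ge> Y" "RS_theta x = pi * of_int \<nu> + \<tau>"
    using RS_theta_inverse[OF assms(2)] .
  then show "gram_t \<nu> \<tau> \<ge> Y" using gram_t(2)[OF nn, of x] by simp
  show "RS_theta (gram_t \<nu> \<tau>) = pi * of_int \<nu> + \<tau>" by (rule gram_t(1)[OF nn])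
qed

text \<open>Beyond Y the function \<theta> is strictly increasing, so an index between two selected
  ones is selected too. A negative \<open>\<nu>\<^sub>0\<close> admits indices to which the lemma
  \<open>gram_t\<close> does not apply; \<open>neg\<close> places them below T.\<close>

lemma gram_index_interval:
  fixes \<nu>\<^sub>0 :: int
  assumes Y: "Y \<ge> exp 8" "RS_theta Y \<ge> 0" "T \<ge> Y"
    and neg: "\<And>\<nu>. \<nu>\<^sub>0 \<le> \<nu> \<Longrightarrow> \<nu> < 0 \<Longrightarrow> gram_t \<nu> 0 < T"
  shows "{\<nu>. \<nu>\<^sub>0 \<le> \<nu> \<and> gram_t \<nu> 0 \<in> {T..T + H}} = {} \<or>
         (\<exists>A B. A \<le> B \<and> {\<nu>. \<nu>\<^sub>0 \<le> \<nu> \<and> gram_t \<nu> 0 \<in> {T..T + H}} = {A..B} \<and>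
           RS_theta (gram_t A 0) = pi * of_int A \<and> RS_theta (gram_t B 0) = pi * of_int B)"
proof -
  define N where "N = {\<nu>. \<nu>\<^sub>0 \<le> \<nu> \<and> gram_t \<nu> 0 \<in> {T..T + H}}"
  have N: "\<nu> \<ge> 0" "RS_theta (gram_t \<nu> 0) = pi * of_int \<nu>" "\<nu>\<^sub>0 \<le> \<nu>"
    "T \<le> gram_t \<nu> 0" "gram_t \<nu> 0 \<le> T + H" if "\<nu> \<in> N" for \<nu>
  proof -
    show "\<nu> \<ge> 0" using that neg[of \<nu>] by (force simp: N_def)
    then show "RS_theta (gram_t \<nu> 0) = pi * of_int \<nu>" using gram_t(1)[of \<nu> 0] by simp
  qed (use that in \<open>auto simp: N_def\<close>)
  have mono: "RS_theta x \<le> RS_theta y" if "T \<le> x" "x \<le> y" for x y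
    using RS_theta_expanding[of x y] that Y by linarith
  have "N \<subseteq> {0..\<lfloor>RS_theta (T + H) / pi\<rfloor>}"
  proof
    fix \<nu> assume \<nu>: "\<nu> \<in> N"
    then have "pi * of_int \<nu> \<le> RS_theta (T + H)" using mono[of "gram_t \<nu> 0" "T + H"] N[OF \<nu>] by simp
    then show "\<nu> \<in> {0..\<lfloor>RS_theta (T + H) / pi\<rfloor>}"
      using N(1)[OF \<nu>] by (simp add: le_floor_iff field_simps)
  qed
  then have fin: "finite N" by (rule finite_subset) simp
  show ?thesis
  proof (cases "N = {}")
    case False
    have AB: "Min N \<in> N" "Max N \<in> N" using fin False by auto
    have "N = {Min N..Max N}"
    proof
      show "N \<subseteq> {Min N..Max N}" using fin by auto
      show "{Min N..Max N} \<subseteq> N"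
      proof
        fix \<nu> assume \<nu>: "\<nu> \<in> {Min N..Max N}"
        then have i: "pi * of_int (Min N) \<le> pi * of_int \<nu>" "pi * of_int \<nu> \<le> pi * of_int (Max N)" by simp_all
        have "RS_theta Y \<le> RS_theta (gram_t (Min N) 0)"
          using RS_theta_expanding[of Y "gram_t (Min N) 0"] N(4)[OF AB(1)] Y by linarith
        then have "RS_theta Y \<le> pi * of_int \<nu> + 0" using i N(2)[OF AB(1)] by linarith
        note g = gram_t_ge[OF Y(2) this]
        have ge: "exp 8 \<le> gram_t (Min N) 0" "exp 8 \<le> gram_t \<nu> 0" "exp 8 \<le> gram_t (Max N) 0"
          using N(4)[OF AB(1)] N(4)[OF AB(2)] g(1) Y(1,3) by linarith+
        have "gram_t (Min N) 0 \<le> gram_t \<nu> 0"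
          by (rule RS_theta_le_cancel[OF ge(1,2)]) (use N(2)[OF AB(1)] g(2) i in linarith)
        moreover have "gram_t \<nu> 0 \<le> gram_t (Max N) 0"
          by (rule RS_theta_le_cancel[OF ge(2,3)]) (use N(2)[OF AB(2)] g(2) i in linarith)
        moreover have "\<nu>\<^sub>0 \<le> \<nu>" using \<nu> N(3)[OF AB(1)] by simp
        ultimately show "\<nu> \<in> N"
          using N(4)[OF AB(1)] N(5)[OF AB(2)] unfolding N_def by simp
      qed
    qed
    moreover have "Min N \<le> Max N" using fin False by simp
    ultimately show ?thesis using N(2) AB unfolding N_def[symmetric] by blast
  qed (simp add: N_def)
qed

lemma cos_at_half_odd:
  fixes A :: int
  shows "cos (2 * ((pi * of_int A + \<tau> - pi / 2) - \<tau>)) = -1" "cos (2 * ((pi * of_int A + \<tau> + pi / 2) - \<tau>)) = -1"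
proof -
  have "2 * ((pi * of_int A + \<tau> - pi / 2) - \<tau>) = 2 * pi * of_int A - pi"
    "2 * ((pi * of_int A + \<tau> + pi / 2) - \<tau>) = 2 * pi * of_int A + pi"
    by (simp_all add: algebra_simps)
  then show "cos (2 * ((pi * of_int A + \<tau> - pi / 2) - \<tau>)) = -1" "cos (2 * ((pi * of_int A + \<tau> + pi / 2) - \<tau>)) = -1"
    by (simp_all only: cos_minus_pi cos_periodic_pi cos_int_2pin)
qed

theorem corollary2:
  fixes \<epsilon> :: real and \<nu>\<^sub>0 :: int
  assumes "lindelof_hypothesis"
    and "\<epsilon> > 0"
  shows "\<exists>C. eventually (\<lambda>T. \<forall>H\<in>{0<..T powr (1 / 6 + \<epsilon>)}. \<forall>\<tau>\<in>{-pi..pi}.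
           norm (F_sum \<nu>\<^sub>0 \<tau> T H - F_sum \<nu>\<^sub>0 0 T H) \<le> C * T powr \<epsilon>) at_top"
proof -
  \<comment> \<open>A large \<epsilon> allows H > T. Right end points are still O(T^(1+\<epsilon>)),
    and (1 + \<epsilon>) * \<eta> \<le> \<epsilon> keeps their powers O(T^\<epsilon>). The cap 1/3
    is the condition \<eta>/2 \<le> 1/6 of \<open>contour_estimates\<close>.\<close>
  define \<eta> where "\<eta> = min (1/3) (\<epsilon> / (1 + \<epsilon>))"
  have \<eta>: "\<eta> > 0" "\<eta> \<le> 1/3" "(1 + \<epsilon>) * \<eta> \<le> \<epsilon>"
  proof -
    show "\<eta> > 0" using assms(2) by (simp add: \<eta>_def)
    show "\<eta> \<le> 1/3" unfolding \<eta>_def by (rule min.cobounded1)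
    have "(1 + \<epsilon>) * \<eta> \<le> (1 + \<epsilon>) * (\<epsilon> / (1 + \<epsilon>))"
      using assms by (intro mult_left_mono) (auto simp: \<eta>_def)
    then show "(1 + \<epsilon>) * \<eta> \<le> \<epsilon>" using assms by simp
  qed
  have d: "0 < \<eta> / 2" "\<eta> / 2 \<le> 1/6" "2 * (\<eta> / 2) = \<eta>" using \<eta> by auto
  obtain K X where K: "K \<ge> 0" and X8: "X \<ge> exp 8"
    and est: "\<And>x. x \<ge> X \<Longrightarrow> norm (Z_form (of_real x)) \<le> K * x powr \<eta>"
    "\<And>x v \<tau>. x \<ge> X \<Longrightarrow> 0 \<le> v \<Longrightarrow> v \<le> 3 \<Longrightarrow> cos (2 * (RS_theta x - \<tau>)) = -1 \<Longrightarrow>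
       norm (Z_form (Complex x (-v)) * gram_phase \<tau> (Complex x (-v)) / (1 - gram_phase \<tau> (Complex x (-v)))) \<le> K * x powr \<eta>"
    "\<And>x v \<tau>. x \<ge> X \<Longrightarrow> 0 \<le> v \<Longrightarrow> v \<le> 3 \<Longrightarrow> cos (2 * (RS_theta x - \<tau>)) = -1 \<Longrightarrow>
       norm (Z_form (Complex x v) / (1 - gram_phase \<tau> (Complex x v))) \<le> K * x powr \<eta>"
    "\<And>x \<tau>. x \<ge> X \<Longrightarrow>
       norm (Z_form (Complex x (-3)) * gram_phase \<tau> (Complex x (-3)) / (1 - gram_phase \<tau> (Complex x (-3)))) \<le> K * x powr (-1/6)"
    "\<And>x \<tau>. x \<ge> X \<Longrightarrow>
       norm (Z_form (Complex x 3) / (1 - gram_phase \<tau> (Complex x 3))) \<le> K * x powr (-1/6)"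
    by (rule contour_estimates[OF assms(1) d(1,2), unfolded d(3)], rule that)
  obtain G where G: "\<And>t. Re t > 0 \<Longrightarrow> (G has_field_derivative Z_form t) (at t)"
    using Z_form_primitive by blast
  have "\<forall>\<^sub>F t in at_top. RS_theta t \<ge> 0 \<and> t \<ge> X + 1"
    using filterlim_RS_theta by (intro eventually_conj eventually_ge_at_top) (simp add: filterlim_at_top)
  then obtain Y where "RS_theta Y \<ge> 0 \<and> Y \<ge> X + 1"
    unfolding eventually_at_top_linorder by blast
  then have Y: "RS_theta Y \<ge> 0" "Y \<ge> X + 1" by simp_all
  have X0: "X > 0" using X8 less_le_trans[OF exp_gt_zero] by blast
  \<comment> \<open>The end points differ in phase from the outermost Gram points for \<tau> = 0 by
    at most |\<tau>| + pi/2 \<le> 3 pi/2, whence the margin 6 around T and T + H.\<close>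
  have pi: "3 * pi / 2 \<le> 6" "pi / 2 \<ge> 0" using pi_less_4 pi_gt_zero by auto

  have G_bound: "norm (G (of_real x) - G (of_real y)) \<le> K * M powr \<eta> * \<bar>x - y\<bar>"
    if xy: "X \<le> x" "X \<le> y" "x \<le> M" "y \<le> M" for x y M
  proof -
    define S where "S = closed_segment (complex_of_real X) (of_real M)"
    have S: "\<exists>u. z = of_real u \<and> X \<le> u \<and> u \<le> M" if "z \<in> S" for z
      using that xy unfolding S_def
      by (auto simp: closed_segment_of_real closed_segment_eq_real_ivl)
    have "norm (G (of_real x) - G (of_real y)) \<le> K * M powr \<eta> * norm (complex_of_real x - of_real y)"
    proof (rule field_differentiable_bound[where S = S])
      show "convex S" by (simp add: S_def)
      show "complex_of_real x \<in> S" "complex_of_real y \<in> S"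
        using xy by (auto simp: S_def closed_segment_of_real closed_segment_eq_real_ivl)
      fix z assume "z \<in> S"
      then obtain u where u: "z = of_real u" "X \<le> u" "u \<le> M" using S by blast
      show "(G has_field_derivative Z_form z) (at z within S)"
        by (rule has_field_derivative_at_within, rule G) (use u X0 in simp)
      have "norm (Z_form z) \<le> K * u powr \<eta>" using est(1)[OF u(2)] u(1) by simp
      also have "\<dots> \<le> K * M powr \<eta>" using u X0 \<eta> K by (intro mult_left_mono powr_mono2) auto
      finally show "norm (Z_form z) \<le> K * M powr \<eta>" .
    qed
    then show ?thesis by (simp flip: of_real_diff)
  qed

  \<comment> \<open>The factor 12 stands for two detours with two vertical sides of length 3 each,
    the factor 2 for the two horizontal sides.\<close>
  have contour: "\<exists>a b. T - 6 \<le> a \<and> a \<le> b \<and> b \<le> T + H + 6 \<and> RS_theta a = pi * of_int A + \<tau> - pi / 2 \<and>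
      RS_theta b = pi * of_int B + \<tau> + pi / 2 \<and>
      norm (of_real pi * (\<Sum>\<nu>\<in>{A..B}. hardy_Z (gram_t \<nu> \<tau>)) - (G (of_real b) - G (of_real a)))
        \<le> 12 * (K * b powr \<eta>) + 2 * ((b - a) * (K * a powr (-1/6)))"
    if T: "T \<ge> Y + 6" and AB: "A \<le> B" "RS_theta (gram_t A 0) = pi * of_int A" "RS_theta (gram_t B 0) = pi * of_int B"
      "T \<le> gram_t A 0" "T \<le> gram_t B 0" "gram_t B 0 \<le> T + H" and \<tau>: "\<tau> \<in> {-pi..pi}" for T H \<tau> A B
  proof -
    have \<tau>': "- pi \<le> \<tau>" "\<tau> \<le> pi" using \<tau> by simp_all
    have pAB: "pi * of_int A \<le> pi * of_int B" using AB(1) by simp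
    have A6: "pi * of_int A \<ge> RS_theta Y + 6"
      using RS_theta_expanding[of Y "gram_t A 0"] AB(2,4) X8 Y(2) T by linarith
    have "RS_theta Y \<le> pi * of_int A + \<tau> - pi / 2" using A6 \<tau>' pi by linarith
    then obtain a where a: "a \<ge> Y" "RS_theta a = pi * of_int A + \<tau> - pi / 2" by (rule RS_theta_inverse)
    have "RS_theta Y \<le> pi * of_int B + \<tau> + pi / 2" using A6 pAB \<tau>' pi by linarith
    then obtain b where b: "b \<ge> Y" "RS_theta b = pi * of_int B + \<tau> + pi / 2" by (rule RS_theta_inverse)
    have aT: "T - 6 \<le> a"
      using RS_theta_expanding[of a "gram_t A 0"] AB(2,4) a \<tau>' pi X8 Y(2) by linarith
    have bT: "b \<le> T + H + 6"
      using RS_theta_expanding[of "gram_t B 0" b] AB(3,5,6) b \<tau>' pi X8 Y(2) T by linarith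
    have S: "exp 8 \<le> gram_t \<nu> \<tau>" "RS_theta (gram_t \<nu> \<tau>) = pi * of_int \<nu> + \<tau>" if "\<nu> \<in> {A..B}" for \<nu>
    proof -
      have "pi * of_int A \<le> pi * of_int \<nu>" using that by simp
      then have "RS_theta Y \<le> pi * of_int \<nu> + \<tau>" using A6 \<tau>' pi by linarith
      from gram_t_ge[OF Y(1) this] X8 Y(2)
      show "exp 8 \<le> gram_t \<nu> \<tau>" "RS_theta (gram_t \<nu> \<tau>) = pi * of_int \<nu> + \<tau>" by auto
    qed
    have a8: "exp 8 < a" and b8: "exp 8 < b" using a(1) b(1) X8 Y(2) by linarith+
    note gc = gram_sum_contour[where S = "\<lambda>\<nu>. gram_t \<nu> \<tau>", OF a8 a(2) b8 b(2) AB(1) S G]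
    have ab: "a \<le> b" by (rule gc(4))
    have aX: "X \<le> a" and bX: "X \<le> b" using a(1) b(1) Y(2) by linarith+
    have cos: "cos (2 * (RS_theta x - \<tau>)) = -1" if "x \<in> {a, b}" for x
      using that cos_at_half_odd[of A \<tau>] cos_at_half_odd[of B \<tau>] by (auto simp only: a(2) b(2))
    have V: "K * x powr \<eta> \<le> K * b powr \<eta>" if "x \<in> {a, b}" for x
      using that ab aX X0 \<eta> K by (intro mult_left_mono powr_mono2) auto
    have U: "K * x powr (-1/6) \<le> K * a powr (-1/6)" if "x \<in> {a..b}" for x
      using that aX X0 K by (intro mult_left_mono powr_mono2') auto
    have low: "norm (contour_integral (detour a b (-3)) (\<lambda>t. Z_form t * gram_phase \<tau> t / (1 - gram_phase \<tau> t)))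
        \<le> 2 * \<bar>-3\<bar> * (K * b powr \<eta>) + (b - a) * (K * a powr (-1/6))"
    proof (rule contour_integral_detour_bound[OF ab gc(2)])
      fix x v :: real assume x: "x \<in> {a, b}" and v: "v \<in> closed_segment 0 (-3)"
      have "0 \<le> -v" "-v \<le> 3" using v by (auto simp: closed_segment_eq_real_ivl)
      from est(2)[OF _ this cos[OF x]] V[OF x] x aX bX
      show "norm (Z_form (Complex x v) * gram_phase \<tau> (Complex x v) / (1 - gram_phase \<tau> (Complex x v))) \<le> K * b powr \<eta>"
        by force
    next
      fix x assume x: "x \<in> {a..b}"
      then have "x \<ge> X" using aX by simp
      from est(4)[OF this, of \<tau>] U[OF x]
      show "norm (Z_form (Complex x (-3)) * gram_phase \<tau> (Complex x (-3)) / (1 - gram_phase \<tau> (Complex x (-3)))) \<le> K * a powr (-1/6)"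
        by linarith
    qed
    have up: "norm (contour_integral (detour a b 3) (\<lambda>t. Z_form t / (1 - gram_phase \<tau> t)))
        \<le> 2 * \<bar>3\<bar> * (K * b powr \<eta>) + (b - a) * (K * a powr (-1/6))"
    proof (rule contour_integral_detour_bound[OF ab gc(3)])
      fix x v :: real assume x: "x \<in> {a, b}" and v: "v \<in> closed_segment 0 3"
      have "0 \<le> v" "v \<le> 3" using v by (auto simp: closed_segment_eq_real_ivl)
      from est(3)[OF _ this cos[OF x]] V[OF x] x aX bX
      show "norm (Z_form (Complex x v) / (1 - gram_phase \<tau> (Complex x v))) \<le> K * b powr \<eta>"
        by force
    next
      fix x assume x: "x \<in> {a..b}"
      then have "x \<ge> X" using aX by simp
      from est(5)[OF this, of \<tau>] U[OF x]
      show "norm (Z_form (Complex x 3) / (1 - gram_phase \<tau> (Complex x 3))) \<le> K * a powr (-1/6)"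
        by linarith
    qed
    define L where "L = contour_integral (detour a b (-3)) (\<lambda>t. Z_form t * gram_phase \<tau> t / (1 - gram_phase \<tau> t))"
    define U where "U = contour_integral (detour a b 3) (\<lambda>t. Z_form t / (1 - gram_phase \<tau> t))"
    have "of_real pi * (\<Sum>\<nu>\<in>{A..B}. hardy_Z (gram_t \<nu> \<tau>)) = G (of_real b) - G (of_real a) + L - U"
      unfolding L_def U_def by (rule gc(1))
    then have "of_real pi * (\<Sum>\<nu>\<in>{A..B}. hardy_Z (gram_t \<nu> \<tau>)) - (G (of_real b) - G (of_real a)) = L - U"
      by simp
    moreover have "norm (L - U) \<le> 12 * (K * b powr \<eta>) + 2 * ((b - a) * (K * a powr (-1/6)))"
      using norm_triangle_ineq4[of L U] low up unfolding L_def[symmetric] U_def[symmetric] by simp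
    ultimately have "norm (of_real pi * (\<Sum>\<nu>\<in>{A..B}. hardy_Z (gram_t \<nu> \<tau>)) - (G (of_real b) - G (of_real a)))
        \<le> 12 * (K * b powr \<eta>) + 2 * ((b - a) * (K * a powr (-1/6)))"
      by simp
    then show ?thesis using a(2) b(2) aT bT ab by blast
  qed

  have "\<forall>\<^sub>F T in at_top. \<forall>\<nu>\<in>{\<nu>\<^sub>0..<0}. gram_t \<nu> 0 < T"
    by (intro eventually_ball_finite ballI eventually_gt_at_top) simp
  \<comment> \<open>200 = 2 * 88 + 2 * 12: the contour errors for \<tau> and for 0, and the
    displacement of the two end points.\<close>
  then have "\<forall>\<^sub>F T in at_top. \<forall>H\<in>{0<..T powr (1 / 6 + \<epsilon>)}. \<forall>\<tau>\<in>{-pi..pi}.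
           norm (F_sum \<nu>\<^sub>0 \<tau> T H - F_sum \<nu>\<^sub>0 0 T H) \<le> 200 * K * T powr \<epsilon>"
    using eventually_ge_at_top[of "Y + 6"] eventually_ge_at_top[of 12]
  proof eventually_elim
    case (elim T)
    show ?case
    proof (intro ballI)
      fix H \<tau> :: real assume H: "H \<in> {0<..T powr (1 / 6 + \<epsilon>)}" and \<tau>: "\<tau> \<in> {-pi..pi}"
      define N where "N = {\<nu>. \<nu>\<^sub>0 \<le> \<nu> \<and> gram_t \<nu> 0 \<in> {T..T + H}}"
      have F: "F_sum \<nu>\<^sub>0 \<sigma> T H = (\<Sum>\<nu>\<in>N. hardy_Z (gram_t \<nu> \<sigma>))" for \<sigma>
        unfolding F_sum_def N_def by simp
      have "N = {} \<or> (\<exists>A B. A \<le> B \<and> N = {A..B} \<and>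
           RS_theta (gram_t A 0) = pi * of_int A \<and> RS_theta (gram_t B 0) = pi * of_int B)"
        unfolding N_def using elim Y X8 by (intro gram_index_interval[of Y]) auto
      then consider "N = {}" | A B where "A \<le> B" "N = {A..B}"
        "RS_theta (gram_t A 0) = pi * of_int A" "RS_theta (gram_t B 0) = pi * of_int B" by blast
      then show "norm (F_sum \<nu>\<^sub>0 \<tau> T H - F_sum \<nu>\<^sub>0 0 T H) \<le> 200 * K * T powr \<epsilon>"
      proof cases
        case 1
        then show ?thesis using K by (simp add: F)
      next
        case (2 A B)
        define M where "M = T + H + 6"
        have inN: "T \<le> gram_t \<nu> 0" "gram_t \<nu> 0 \<le> T + H" if "\<nu> \<in> {A..B}" for \<nu>
          using that unfolding 2(2)[symmetric] by (auto simp: N_def)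
        have T1: "T \<ge> 1" using elim by simp
        have H': "0 < H" "H \<le> T powr (1/6 + \<epsilon>)" using H by simp_all
        have P1: "T powr (1/6 + \<epsilon>) \<ge> 1" using T1 assms by (intro ge_one_powr_ge_zero) auto
        have M\<eta>: "M powr \<eta> \<le> 3 * T powr \<epsilon>"
        proof -
          have "T powr 1 \<le> T powr (1 + \<epsilon>)" "T powr (1/6 + \<epsilon>) \<le> T powr (1 + \<epsilon>)"
            using T1 assms by (intro powr_mono; simp)+
          moreover have "T powr 1 = T" using T1 by simp
          ultimately have "M \<le> 3 * T powr (1 + \<epsilon>)" using H' elim(3) unfolding M_def by linarith
          then have "M powr \<eta> \<le> (3 * T powr (1 + \<epsilon>)) powr \<eta>"
            using \<eta> H' T1 by (intro powr_mono2) (auto simp: M_def)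
          also have "\<dots> = 3 powr \<eta> * T powr ((1 + \<epsilon>) * \<eta>)"
            by (simp add: powr_mult powr_powr)
          also have "\<dots> \<le> 3 powr 1 * T powr \<epsilon>"
            using \<eta> T1 by (intro mult_mono powr_mono) auto
          finally show ?thesis by simp
        qed
        \<comment> \<open>88 = 12 * 3 + 2 * 26. The length b - a is at most H + 12 \<le> 13
          T^(1/6+\<epsilon>), and a \<ge> T/2, from T \<ge> 12, costs a factor 2. This is where
          T^(1/6+\<epsilon>) meets T^(-1/6).\<close>
        have err: "12 * (K * b powr \<eta>) + 2 * ((b - a) * (K * a powr (-1/6))) \<le> 88 * (K * T powr \<epsilon>)"
          if "T - 6 \<le> a" "a \<le> b" "b \<le> M" for a b
        proof -
          have "b powr \<eta> \<le> M powr \<eta>" using that elim \<eta> by (intro powr_mono2) auto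
          then have 1: "K * b powr \<eta> \<le> K * (3 * T powr \<epsilon>)"
            using M\<eta> K by (intro mult_left_mono) auto
          have "a powr (-1/6) \<le> (T / 2) powr (-1/6)"
            using that elim by (intro powr_mono2') auto
          also have "\<dots> = 2 powr (1/6) * T powr (-1/6)"
            using T1 by (simp add: powr_divide powr_minus_divide)
          also have "\<dots> \<le> 2 powr 1 * T powr (-1/6)"
            by (intro mult_right_mono powr_mono) auto
          finally have "a powr (-1/6) \<le> 2 * T powr (-1/6)" by simp
          moreover have "b - a \<le> 13 * T powr (1/6 + \<epsilon>)"
            using that H' P1 unfolding M_def by linarith
          ultimately have "(b - a) * (K * a powr (-1/6)) \<le> (13 * T powr (1/6 + \<epsilon>)) * (K * (2 * T powr (-1/6)))"
            using that K by (intro mult_mono mult_left_mono) auto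
          also have "\<dots> = 26 * (K * (T powr (1/6 + \<epsilon>) * T powr (-1/6)))" by simp
          also have "T powr (1/6 + \<epsilon>) * T powr (-1/6) = T powr \<epsilon>" by (simp flip: powr_add)
          finally show ?thesis using 1 by simp
        qed
        have c: "\<exists>a b. T - 6 \<le> a \<and> a \<le> b \<and> b \<le> M \<and> RS_theta a = pi * of_int A + \<sigma> - pi / 2 \<and>
          RS_theta b = pi * of_int B + \<sigma> + pi / 2 \<and>
          norm (of_real pi * F_sum \<nu>\<^sub>0 \<sigma> T H - (G (of_real b) - G (of_real a))) \<le> 88 * (K * T powr \<epsilon>)"
          if \<sigma>: "\<sigma> \<in> {-pi..pi}" for \<sigma>
        proof -
          have "A \<in> {A..B}" "B \<in> {A..B}" using 2(1) by simp_all
          from contour[OF elim(2) 2(1,3,4) inN(1)[OF this(1)] inN(1)[OF this(2)] inN(2)[OF this(2)] \<sigma>]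
          obtain a b where ab: "T - 6 \<le> a" "a \<le> b" "b \<le> T + H + 6" "RS_theta a = pi * of_int A + \<sigma> - pi / 2"
            "RS_theta b = pi * of_int B + \<sigma> + pi / 2"
            "norm (of_real pi * (\<Sum>\<nu>\<in>{A..B}. hardy_Z (gram_t \<nu> \<sigma>)) - (G (of_real b) - G (of_real a)))
              \<le> 12 * (K * b powr \<eta>) + 2 * ((b - a) * (K * a powr (-1/6)))"
            by blast
          have bM: "b \<le> M" using ab(3) by (simp add: M_def)
          from order.trans[OF ab(6) err[OF ab(1,2) bM]] ab(1,2,4,5) bM show ?thesis
            unfolding F 2(2) by blast
        qed
        obtain a b where ab: "T - 6 \<le> a" "a \<le> b" "b \<le> M" "RS_theta a = pi * of_int A + \<tau> - pi / 2"
          "RS_theta b = pi * of_int B + \<tau> + pi / 2"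
          "norm (of_real pi * F_sum \<nu>\<^sub>0 \<tau> T H - (G (of_real b) - G (of_real a))) \<le> 88 * (K * T powr \<epsilon>)"
          using c[OF \<tau>] by blast
        obtain a' b' where ab': "T - 6 \<le> a'" "a' \<le> b'" "b' \<le> M" "RS_theta a' = pi * of_int A + 0 - pi / 2"
          "RS_theta b' = pi * of_int B + 0 + pi / 2"
          "norm (of_real pi * F_sum \<nu>\<^sub>0 0 T H - (G (of_real b') - G (of_real a'))) \<le> 88 * (K * T powr \<epsilon>)"
          using c[of 0] by auto
        \<comment> \<open>Passing from \<tau> to 0 shifts the phase of an end point by |\<tau>|
          \<le> pi, hence the point by less than 4; the 12 is 3 * 4.\<close>
        have close: "norm (G (of_real x) - G (of_real y)) \<le> 12 * (K * T powr \<epsilon>)"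
          if "T - 6 \<le> x" "T - 6 \<le> y" "x \<le> M" "y \<le> M" "\<bar>RS_theta x - RS_theta y\<bar> = \<bar>\<tau>\<bar>" for x y
        proof -
          have X: "X \<le> x" "X \<le> y" using that(1,2) elim(2) Y(2) by linarith+
          have "\<bar>x - y\<bar> \<le> \<bar>RS_theta x - RS_theta y\<bar>"
          proof (cases "x \<le> y")
            case True
            then show ?thesis using RS_theta_expanding[OF order.trans[OF X8 X(1)] True] by linarith
          next
            case False
            then have "y \<le> x" by simp
            then show ?thesis using RS_theta_expanding[OF order.trans[OF X8 X(2)] \<open>y \<le> x\<close>] by linarith
          qed
          moreover have "\<bar>\<tau>\<bar> \<le> pi" using \<tau> by auto
          ultimately have "\<bar>x - y\<bar> \<le> 4" using that(5) pi_less_4 by linarith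
          then have "K * M powr \<eta> * \<bar>x - y\<bar> \<le> K * (3 * T powr \<epsilon>) * 4"
            using M\<eta> K by (intro mult_mono mult_left_mono) auto
          then show ?thesis using G_bound[OF X that(3,4)] by simp
        qed
        have ga: "norm (G (of_real a) - G (of_real a')) \<le> 12 * (K * T powr \<epsilon>)"
        proof (rule close)
          show "\<bar>RS_theta a - RS_theta a'\<bar> = \<bar>\<tau>\<bar>" unfolding ab(4) ab'(4) by simp
        qed (use ab(1-3) ab'(1-3) in linarith)+
        have gb: "norm (G (of_real b) - G (of_real b')) \<le> 12 * (K * T powr \<epsilon>)"
        proof (rule close)
          show "\<bar>RS_theta b - RS_theta b'\<bar> = \<bar>\<tau>\<bar>" unfolding ab(5) ab'(5) by simp
        qed (use ab(1-3) ab'(1-3) in linarith)+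
        define e1 where "e1 = of_real pi * F_sum \<nu>\<^sub>0 \<tau> T H - (G (of_real b) - G (of_real a))"
        define e0 where "e0 = of_real pi * F_sum \<nu>\<^sub>0 0 T H - (G (of_real b') - G (of_real a'))"
        have "of_real pi * (F_sum \<nu>\<^sub>0 \<tau> T H - F_sum \<nu>\<^sub>0 0 T H) =
          (e1 - e0) + ((G (of_real b) - G (of_real b')) - (G (of_real a) - G (of_real a')))"
          by (simp add: e1_def e0_def algebra_simps)
        also have "norm \<dots> \<le> 200 * (K * T powr \<epsilon>)"
          using norm_triangle_ineq[of "e1 - e0" "(G (of_real b) - G (of_real b')) - (G (of_real a) - G (of_real a'))"]
            norm_triangle_ineq4[of e1 e0]
            norm_triangle_ineq4[of "G (of_real b) - G (of_real b')" "G (of_real a) - G (of_real a')"]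
            ab(6)[folded e1_def] ab'(6)[folded e0_def] ga gb
          by linarith
        finally have "pi * norm (F_sum \<nu>\<^sub>0 \<tau> T H - F_sum \<nu>\<^sub>0 0 T H) \<le> 200 * (K * T powr \<epsilon>)"
          by (simp add: norm_mult)
        moreover have "1 * norm (F_sum \<nu>\<^sub>0 \<tau> T H - F_sum \<nu>\<^sub>0 0 T H) \<le> pi * norm (F_sum \<nu>\<^sub>0 \<tau> T H - F_sum \<nu>\<^sub>0 0 T H)"
          using pi_gt3 by (intro mult_right_mono) auto
        ultimately show ?thesis by simp
      qed
    qed
  qed
  then show ?thesis by blast
qed

end
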